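(* Let $n\ge 1$ and real parameters $\alpha,\beta,\gamma$ be such that the integrals below converge. Then \[ \left\langle x_1^{-2}\right\rangle_{n,\alpha,\beta,\gamma} = \frac{\alpha+\beta+(n-1)\gamma-1}{(\alpha-1)(\alpha-2)}\cdot\left(\alpha+\beta - 2 + \frac{\gamma(n-1)(\alpha+\beta+n\gamma-1)}{\alpha+\gamma -1}\right). \]
   Context: Define the weight on $[0,1]^n$ \[w_{n,\alpha,\beta,\gamma}(x) = \prod_{i<j}|x_i-x_j|^{2\gamma}\prod_{i=1}^{n}x_i^{\alpha-1}\prod_{i=1}^{n}(1-x_i)^{\beta-1},\] and for a function $f$ define the average \[\left\langle f(x_1,\ldots,x_n)\right\rangle_{n,\alpha,\beta,\gamma} = \frac{\int_0^{1}\cdots\int_{0}^{1}f(x_1,\ldots,x_n)\,w_{n,\alpha,\beta,\gamma}(x)\,dx}{\int_0^{1}\cdots\int_{0}^{1}w_{n,\alpha,\beta,\gamma}(x)\,dx}\] (the Jacobi Ensemble average). *)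

theory Defs
  imports "HOL-Analysis.Analysis"
begin

text \<open>Points of [0,1]^n are functions x :: nat => real, with coordinates x 0, ..., x (n-1)
  (the paper's x_1, ..., x_n). The measure is Lebesgue measure on [0,1]^n, realised as the
  finite product of Lebesgue measure restricted to [0,1].\<close>

definition jacobi_measure :: "nat \<Rightarrow> (nat \<Rightarrow> real) measure" where
  "jacobi_measure n = PiM {..<n} (\<lambda>_. restrict_space lborel {0..1::real})"

definition jacobi_weight :: "nat \<Rightarrow> real \<Rightarrow> real \<Rightarrow> real \<Rightarrow> (nat \<Rightarrow> real) \<Rightarrow> real" where
  "jacobi_weight n \<alpha> \<beta> \<gamma> x =
     (\<Prod>i<n. \<Prod>j\<in>{i<..<n}. \<bar>x i - x j\<bar> powr (2 * \<gamma>)) *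
     (\<Prod>i<n. x i powr (\<alpha> - 1)) *
     (\<Prod>i<n. (1 - x i) powr (\<beta> - 1))"

definition jacobi_avg :: "nat \<Rightarrow> real \<Rightarrow> real \<Rightarrow> real \<Rightarrow> ((nat \<Rightarrow> real) \<Rightarrow> real) \<Rightarrow> real" where
  "jacobi_avg n \<alpha> \<beta> \<gamma> f =
     (\<integral>x. f x * jacobi_weight n \<alpha> \<beta> \<gamma> x \<partial>jacobi_measure n) /
     (\<integral>x. jacobi_weight n \<alpha> \<beta> \<gamma> x \<partial>jacobi_measure n)"

end

theory Submission
  imports Defs "HOL-Probability.Infinite_Product_Measure"
begin

text \<open>
  Substitute \<open>x i + t * v (x i)\<close> for every coordinate simultaneously, where \<open>v\<close> vanishes at 0 and 1.
  Differences of coordinates are then multiplied by factors close to 1, so that the derivative of the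
  transformed integral at \<open>t = 0\<close> is dominated by a multiple of the weight for every exponent \<open>\<gamma>\<close>,
  negative ones included, and no integration by parts across the diagonals is needed. Since the
  integral does not depend on \<open>t\<close>, the weighted integral of the logarithmic divergence vanishes.

  Approximating the fields \<open>1 - z\<close> and \<open>1 / z - 1\<close> by \<open>z * (1 - z) / (z + \<epsilon>)\<close> and
  \<open>z * (1 - z) / (z + \<epsilon>)\<^sup>2\<close> yields three linear relations between the averages of \<open>1 / x 0\<close>,
  \<open>1 / (x 0)\<^sup>2\<close> and \<open>1 / (x 0 * x j)\<close>: from \<open>1 - z\<close> with test functions \<open>1\<close> and \<open>1 / x 0\<close>, and from
  \<open>1 / z - 1\<close> with test function \<open>1\<close>. They determine the average of \<open>1 / (x 0)\<^sup>2\<close>, because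
  convergence of the integrals forces \<open>\<alpha> > 2\<close> and, for \<open>n \<ge> 2\<close>, \<open>\<gamma> > -1/2\<close>.
\<close>

section \<open>Change of variables on the unit interval and the unit cube\<close>

abbreviation unit_lborel :: "real measure" where
  "unit_lborel \<equiv> restrict_space lborel {0..1}"

lemma space_unit_lborel: "space unit_lborel = {0..1}"
  by (simp add: space_restrict_space)

lemma sets_unit_lborel_borel: "A \<in> sets unit_lborel \<Longrightarrow> A \<in> sets borel \<and> A \<subseteq> {0..1}"
  by (auto simp: sets_restrict_space)

lemma prob_space_unit_lborel: "prob_space unit_lborel"
  by (rule prob_spaceI) (simp add: space_unit_lborel emeasure_restrict_space)

interpretation unit_product: product_sigma_finite "\<lambda>_::nat. unit_lborel"
  by unfold_locales
    (rule sigma_finite_measure.sigma_finite_countable[OF prob_space_imp_sigma_finite[OF prob_space_unit_lborel]])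

lemma nn_integral_unit_lborel:
  "(\<integral>\<^sup>+x. f x \<partial>unit_lborel) = (\<integral>\<^sup>+x. f x * indicator {0..1} x \<partial>lborel)"
  by (rule nn_integral_restrict_space) simp

lemma measurable_unit_lborelI:
  assumes "continuous_on {0..1} f"
  shows "f \<in> borel_measurable unit_lborel"
proof -
  have "f \<in> borel_measurable (restrict_space borel {0..1})"
    using assms by (rule borel_measurable_continuous_on_restrict)
  then show ?thesis
    using measurable_cong_sets[of unit_lborel "restrict_space borel {0..1}" borel borel]
    by (simp add: sets_restrict_space)
qed

text \<open>The one-dimensional change of variables, phrased through indicators: a finite product
  measure is determined by its values on boxes, and the measure of a box factors into integrals of
  exactly this form.\<close>

lemma unit_substitution:
  fixes g g' :: "real \<Rightarrow> real"
  assumes deriv: "\<And>x. x \<in> {0..1} \<Longrightarrow> (g has_real_derivative g' x) (at x)"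
    and cont: "continuous_on {0..1} g'"
    and nonneg: "\<And>x. x \<in> {0..1} \<Longrightarrow> 0 \<le> g' x"
    and ends: "g 0 = 0" "g 1 = 1"
    and B: "B \<in> sets unit_lborel"
  shows "(\<integral>\<^sup>+x. ennreal (g' x) * indicator B (g x) \<partial>unit_lborel) = emeasure unit_lborel B"
proof -
  have B': "B \<in> sets borel" "B \<subseteq> {0..1}"
    using sets_unit_lborel_borel[OF B] by auto
  have "(\<integral>\<^sup>+x. ennreal (indicator B x * indicator {g 0..g 1} x) \<partial>lborel)
     = (\<integral>\<^sup>+x. ennreal (indicator B (g x) * g' x * indicator {0..1} x) \<partial>lborel)"
    using B' by (intro nn_integral_substitution deriv cont nonneg) (simp_all add: set_borel_measurable_def)
  also have "(\<integral>\<^sup>+x. ennreal (indicator B x * indicator {g 0..g 1} x) \<partial>lborel)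
     = (\<integral>\<^sup>+x. indicator B x \<partial>lborel)"
    using B' ends by (intro nn_integral_cong) (auto simp: indicator_def)
  also have "\<dots> = emeasure unit_lborel B"
    using B' by (simp add: emeasure_restrict_space)
  also have "(\<integral>\<^sup>+x. ennreal (indicator B (g x) * g' x * indicator {0..1} x) \<partial>lborel)
     = (\<integral>\<^sup>+x. (ennreal (g' x) * indicator B (g x)) * indicator {0..1} x \<partial>lborel)"
    by (intro nn_integral_cong) (auto simp: indicator_def)
  finally show ?thesis
    by (simp add: nn_integral_unit_lborel)
qed

text \<open>All coordinates are substituted independently, so the Jacobian determinant is a product
  of one-dimensional derivatives. On a box \<open>Pi\<^sub>E I B\<close> density and indicator both
  split over the coordinates, the integral becomes a product of one-dimensional ones, and uniqueness
  of the product measure concludes.\<close>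

lemma unit_product_substitution:
  fixes g g' :: "real \<Rightarrow> real" and I :: "nat set"
  assumes I: "finite I"
    and deriv: "\<And>x. x \<in> {0..1} \<Longrightarrow> (g has_real_derivative g' x) (at x)"
    and cont: "continuous_on {0..1} g'"
    and nonneg: "\<And>x. x \<in> {0..1} \<Longrightarrow> 0 \<le> g' x"
    and ends: "g 0 = 0" "g 1 = 1"
    and maps: "\<And>x. x \<in> {0..1} \<Longrightarrow> g x \<in> {0..1}"
  shows "distr (density (PiM I (\<lambda>_. unit_lborel)) (\<lambda>x. ennreal (\<Prod>i\<in>I. g' (x i))))
           (PiM I (\<lambda>_. unit_lborel)) (\<lambda>x. \<lambda>i\<in>I. g (x i)) = PiM I (\<lambda>_. unit_lborel)"
    and "(\<lambda>x. \<lambda>i\<in>I. g (x i)) \<in> measurable (PiM I (\<lambda>_. unit_lborel)) (PiM I (\<lambda>_. unit_lborel))"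
    and "(\<lambda>x. \<Prod>i\<in>I. g' (x i)) \<in> borel_measurable (PiM I (\<lambda>_. unit_lborel))"
proof -
  let ?P = "PiM I (\<lambda>_. unit_lborel)"
  let ?G = "\<lambda>x. \<lambda>i\<in>I. g (x i)"
  have "continuous_on {0..1} g"
    using deriv by (meson DERIV_atLeastAtMost_imp_continuous_on atLeastAtMost_iff)
  then have "g \<in> borel_measurable unit_lborel"
    by (rule measurable_unit_lborelI)
  then have gm: "g \<in> measurable unit_lborel unit_lborel"
    by (intro measurable_restrict_space2) (use maps in \<open>auto simp: space_unit_lborel\<close>)
  have g'm: "g' \<in> borel_measurable unit_lborel"
    by (rule measurable_unit_lborelI[OF cont])
  have comp: "(\<lambda>x. x i) \<in> measurable ?P unit_lborel" if "i \<in> I" for i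
    using that by (rule measurable_component_singleton)
  show Gm: "?G \<in> measurable ?P ?P"
    by (rule measurable_restrict) (use measurable_compose[OF comp gm] in blast)
  show Dm: "(\<lambda>x. \<Prod>i\<in>I. g' (x i)) \<in> borel_measurable ?P"
    by (rule borel_measurable_prod) (use measurable_compose[OF comp g'm] in blast)
  show "distr (density ?P (\<lambda>x. ennreal (\<Prod>i\<in>I. g' (x i)))) ?P ?G = ?P"
  proof (rule unit_product.PiM_eqI[OF I])
    show "sets (distr (density ?P (\<lambda>x. ennreal (\<Prod>i\<in>I. g' (x i)))) ?P ?G) = sets ?P"
      by simp
    fix B assume B: "\<And>i. i \<in> I \<Longrightarrow> B i \<in> sets unit_lborel"
    have BP: "Pi\<^sub>E I B \<in> sets ?P"
      using I B by (rule sets_PiM_I_finite)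
    have "emeasure (distr (density ?P (\<lambda>x. ennreal (\<Prod>i\<in>I. g' (x i)))) ?P ?G) (Pi\<^sub>E I B)
       = emeasure (density ?P (\<lambda>x. ennreal (\<Prod>i\<in>I. g' (x i)))) (?G -` Pi\<^sub>E I B \<inter> space ?P)"
      using Gm BP by (subst emeasure_distr) auto
    also have "\<dots> = (\<integral>\<^sup>+x. ennreal (\<Prod>i\<in>I. g' (x i)) * indicator (?G -` Pi\<^sub>E I B \<inter> space ?P) x \<partial>?P)"
      using Dm Gm BP by (intro emeasure_density measurable_sets) auto
    also have "\<dots> = (\<integral>\<^sup>+x. (\<Prod>i\<in>I. ennreal (g' (x i)) * indicator (B i) (g (x i))) \<partial>?P)"
    proof (rule nn_integral_cong)
      fix x assume x: "x \<in> space ?P"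
      then have x01: "x i \<in> {0..1}" if "i \<in> I" for i
        using that by (auto simp: space_PiM space_unit_lborel PiE_iff)
      have "ennreal (\<Prod>i\<in>I. g' (x i)) = (\<Prod>i\<in>I. ennreal (g' (x i)))"
        using nonneg x01 by (intro prod_ennreal[symmetric]) auto
      moreover have "indicator (?G -` Pi\<^sub>E I B \<inter> space ?P) x = (\<Prod>i\<in>I. indicator (B i) (g (x i)) :: ennreal)"
      proof (cases "\<forall>i\<in>I. g (x i) \<in> B i")
        case True
        then show ?thesis using x by (auto simp: indicator_def PiE_iff)
      next
        case False
        then have "(\<Prod>i\<in>I. indicator (B i) (g (x i)) :: ennreal) = 0"
          using I by (simp add: prod_zero_iff) (metis indicator_simps(2))
        then show ?thesis using False by (auto simp: indicator_def PiE_iff)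
      qed
      ultimately show "ennreal (\<Prod>i\<in>I. g' (x i)) * indicator (?G -` Pi\<^sub>E I B \<inter> space ?P) x
         = (\<Prod>i\<in>I. ennreal (g' (x i)) * indicator (B i) (g (x i)))"
        by (simp add: prod.distrib)
    qed
    also have "\<dots> = (\<Prod>i\<in>I. \<integral>\<^sup>+x. ennreal (g' x) * indicator (B i) (g x) \<partial>unit_lborel)"
    proof (rule unit_product.product_nn_integral_prod[OF I])
      fix i assume "i \<in> I"
      have [measurable]: "g \<in> measurable unit_lborel unit_lborel" "g' \<in> borel_measurable unit_lborel"
        "B i \<in> sets unit_lborel" using gm g'm B \<open>i \<in> I\<close> by auto
      show "(\<lambda>x. ennreal (g' x) * indicator (B i) (g x)) \<in> borel_measurable unit_lborel"
        by measurable
    qed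
    also have "\<dots> = (\<Prod>i\<in>I. emeasure unit_lborel (B i))"
      using unit_substitution[OF deriv cont nonneg ends B] by (intro prod.cong) auto
    finally show "emeasure (distr (density ?P (\<lambda>x. ennreal (\<Prod>i\<in>I. g' (x i)))) ?P ?G) (Pi\<^sub>E I B)
       = (\<Prod>i\<in>I. emeasure unit_lborel (B i))" .
  qed
qed

lemma unit_product_integral_substitution:
  fixes g g' :: "real \<Rightarrow> real" and I :: "nat set" and f :: "(nat \<Rightarrow> real) \<Rightarrow> real"
  assumes I: "finite I"
    and deriv: "\<And>x. x \<in> {0..1} \<Longrightarrow> (g has_real_derivative g' x) (at x)"
    and cont: "continuous_on {0..1} g'"
    and nonneg: "\<And>x. x \<in> {0..1} \<Longrightarrow> 0 \<le> g' x"
    and ends: "g 0 = 0" "g 1 = 1"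
    and maps: "\<And>x. x \<in> {0..1} \<Longrightarrow> g x \<in> {0..1}"
    and f: "f \<in> borel_measurable (PiM I (\<lambda>_. unit_lborel))"
  shows "(\<integral>x. (\<Prod>i\<in>I. g' (x i)) * f (\<lambda>i\<in>I. g (x i)) \<partial>PiM I (\<lambda>_. unit_lborel))
       = (\<integral>x. f x \<partial>PiM I (\<lambda>_. unit_lborel))"
proof -
  let ?P = "PiM I (\<lambda>_. unit_lborel)"
  let ?G = "\<lambda>x. \<lambda>i\<in>I. g (x i)"
  note sub = unit_product_substitution[OF I deriv cont nonneg ends maps]
  have "(\<integral>x. f x \<partial>?P) = (\<integral>x. f x \<partial>distr (density ?P (\<lambda>x. ennreal (\<Prod>i\<in>I. g' (x i)))) ?P ?G)"
    using sub(1) by simp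
  also have "\<dots> = (\<integral>x. f (?G x) \<partial>density ?P (\<lambda>x. ennreal (\<Prod>i\<in>I. g' (x i))))"
    using sub(2) f by (intro integral_distr) auto
  also have "\<dots> = (\<integral>x. (\<Prod>i\<in>I. g' (x i)) *\<^sub>R f (?G x) \<partial>?P)"
  proof (rule integral_density)
    show "(\<lambda>x. f (?G x)) \<in> borel_measurable ?P"
      using measurable_compose[OF sub(2) f] .
    show "AE x in ?P. 0 \<le> (\<Prod>i\<in>I. g' (x i))"
      using nonneg by (intro AE_I2 prod_nonneg) (auto simp: space_PiM space_unit_lborel PiE_iff)
  qed (rule sub(3))
  finally show ?thesis by simp
qed

subsection \<open>Invariance of the weighted integral\<close>

text \<open>The product runs over ordered pairs, so the exponent \<open>c\<close> is the \<open>\<gamma>\<close> of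
  \<^const>\<open>jacobi_weight\<close>, not \<open>2 \<gamma>\<close>. The exponents at the origin may depend on the coordinate:
  this absorbs the test function \<open>1 / x 0\<close> into the weight.\<close>

definition selberg_weight :: "nat \<Rightarrow> (nat \<Rightarrow> real) \<Rightarrow> real \<Rightarrow> real \<Rightarrow> (nat \<Rightarrow> real) \<Rightarrow> real" where
  "selberg_weight n a b c x =
     (\<Prod>i<n. \<Prod>j\<in>{..<n} - {i}. \<bar>x i - x j\<bar> powr c) *
     (\<Prod>i<n. x i powr (a i - 1)) * (\<Prod>i<n. (1 - x i) powr (b - 1))"

text \<open>Each off-diagonal row is cut into \<open>j < i\<close> and \<open>i < j\<close>.
  Exchanging the two products turns the first half into the second with the arguments swapped, which
  \<open>sym\<close> undoes.\<close>

lemma prod_unordered_pairs: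
  fixes g :: "nat \<Rightarrow> nat \<Rightarrow> 'a :: comm_monoid_mult"
  assumes sym: "\<And>i j. g i j = g j i"
  shows "(\<Prod>i<n. \<Prod>j\<in>{i<..<n}. g i j * g i j) = (\<Prod>i<n. \<Prod>j\<in>{..<n} - {i}. g i j)"
proof -
  have split: "{..<n} - {i} = {..<i} \<union> {i<..<n}" if "i < n" for i
    using that by auto
  have "(\<Prod>i<n. \<Prod>j\<in>{..<n} - {i}. g i j)
      = (\<Prod>i<n. (\<Prod>j<i. g i j) * (\<Prod>j\<in>{i<..<n}. g i j))"
  proof (rule prod.cong[OF refl])
    fix i assume "i \<in> {..<n}"
    then show "(\<Prod>j\<in>{..<n} - {i}. g i j) = (\<Prod>j<i. g i j) * (\<Prod>j\<in>{i<..<n}. g i j)"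
      by (subst split, simp, subst prod.union_disjoint) auto
  qed
  also have "\<dots> = (\<Prod>i<n. \<Prod>j<i. g i j) * (\<Prod>i<n. \<Prod>j\<in>{i<..<n}. g i j)"
    by (simp add: prod.distrib)
  also have "(\<Prod>i<n. \<Prod>j<i. g i j) = (\<Prod>i<n. \<Prod>j\<in>{j. j \<in> {..<n} \<and> j < i}. g i j)"
    by (intro prod.cong) auto
  also have "\<dots> = (\<Prod>j<n. \<Prod>i\<in>{i. i \<in> {..<n} \<and> j < i}. g i j)"
    by (rule prod.swap_restrict) auto
  also have "\<dots> = (\<Prod>j<n. \<Prod>i\<in>{j<..<n}. g j i)"
    using sym by (intro prod.cong) auto
  finally show ?thesis
    by (simp add: prod.distrib)
qed

lemma jacobi_weight_eq_selberg_weight: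
  "jacobi_weight n \<alpha> \<beta> \<gamma> = selberg_weight n (\<lambda>_. \<alpha>) \<beta> \<gamma>"
proof
  fix x
  have "(\<Prod>i<n. \<Prod>j\<in>{i<..<n}. \<bar>x i - x j\<bar> powr (2 * \<gamma>))
      = (\<Prod>i<n. \<Prod>j\<in>{i<..<n}. \<bar>x i - x j\<bar> powr \<gamma> * \<bar>x i - x j\<bar> powr \<gamma>)"
    by (simp add: powr_add[symmetric])
  also have "\<dots> = (\<Prod>i<n. \<Prod>j\<in>{..<n} - {i}. \<bar>x i - x j\<bar> powr \<gamma>)"
    by (rule prod_unordered_pairs) (simp add: abs_minus_commute)
  finally show "jacobi_weight n \<alpha> \<beta> \<gamma> x = selberg_weight n (\<lambda>_. \<alpha>) \<beta> \<gamma> x"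
    by (simp add: jacobi_weight_def selberg_weight_def)
qed

lemma selberg_weight_nonneg: "0 \<le> selberg_weight n a b c x"
  unfolding selberg_weight_def by (intro mult_nonneg_nonneg prod_nonneg) auto

lemma space_jacobi_measure: "x \<in> space (jacobi_measure n) \<Longrightarrow> i < n \<Longrightarrow> x i \<in> {0..1}"
  by (auto simp: jacobi_measure_def space_PiM space_unit_lborel PiE_iff)

lemma measurable_coordinate [measurable]:
  "i < n \<Longrightarrow> (\<lambda>x. x i) \<in> borel_measurable (jacobi_measure n)"
proof -
  assume "i < n"
  then have "(\<lambda>x. x i) \<in> measurable (jacobi_measure n) unit_lborel"
    unfolding jacobi_measure_def by (intro measurable_component_singleton) auto
  then show ?thesis
    by (rule measurable_compose) (rule measurable_unit_lborelI, rule continuous_on_id)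
qed

lemma measurable_selberg_weight [measurable]:
  "selberg_weight n a b c \<in> borel_measurable (jacobi_measure n)"
  unfolding selberg_weight_def[abs_def]
  by (intro borel_measurable_times borel_measurable_prod powr_real_measurable
      borel_measurable_abs borel_measurable_diff measurable_coordinate) auto

text \<open>Below, \<open>v\<close> is a vector field on \<open>[0,1]\<close> vanishing at both ends, written as
  \<open>v z = z * u z = (1 - z) * y z\<close>, with divided difference \<open>d z w = (v z - v w) / (z - w)\<close>
  extended to the diagonal by the derivative. Under \<open>z \<mapsto> z + t * v z\<close> every factor of the weight
  is multiplied by a power of \<open>1 + t * d\<close>, \<open>1 + t * u\<close> or \<open>1 - t * y\<close>; the diagonal terms
  \<open>i = j\<close> of the double sum account for the Jacobian determinant.\<close>

definition log_jacobian :: "nat \<Rightarrow> (nat \<Rightarrow> real) \<Rightarrow> real \<Rightarrow> real \<Rightarrow> (real \<Rightarrow> real \<Rightarrow> real) \<Rightarrow>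
    (real \<Rightarrow> real) \<Rightarrow> (real \<Rightarrow> real) \<Rightarrow> real \<Rightarrow> (nat \<Rightarrow> real) \<Rightarrow> real" where
  "log_jacobian n a b c d u y t x =
     (\<Sum>i<n. \<Sum>j<n. (if i = j then 1 else c) * ln (1 + t * d (x i) (x j))) +
     (\<Sum>i<n. (a i - 1) * ln (1 + t * u (x i)) + (b - 1) * ln (1 - t * y (x i)))"

text \<open>Formally this is \<open>div (W v) / W\<close> for the weight \<open>W\<close> and the
  field with components \<open>v (x i)\<close>: \<open>u\<close> and \<open>y\<close> are the
  quotients of \<open>v\<close> by \<open>z\<close> and \<open>1 - z\<close>, and a pair of distinct
  indices is met twice, which restores the exponent \<open>2 * c\<close>.\<close>

definition weight_divergence :: "nat \<Rightarrow> (nat \<Rightarrow> real) \<Rightarrow> real \<Rightarrow> real \<Rightarrow> (real \<Rightarrow> real \<Rightarrow> real) \<Rightarrow>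
    (real \<Rightarrow> real) \<Rightarrow> (real \<Rightarrow> real) \<Rightarrow> (nat \<Rightarrow> real) \<Rightarrow> real" where
  "weight_divergence n a b c d u y x =
     (\<Sum>i<n. \<Sum>j<n. (if i = j then 1 else c) * d (x i) (x j)) +
     (\<Sum>i<n. (a i - 1) * u (x i) - (b - 1) * y (x i))"

text \<open>The three factorisations of \<open>v\<close> and of its differences make every perturbed
  factor a multiple of the original one. The multipliers are positive, so \<open>powr\<close>
  distributes over them and their powers can be collected in a single exponential.\<close>

lemma selberg_weight_perturb:
  fixes x :: "nat \<Rightarrow> real"
  assumes x: "\<And>i. i < n \<Longrightarrow> x i \<in> {0..1}"
    and u: "\<And>z. z \<in> {0..1} \<Longrightarrow> v z = z * u z"
    and y: "\<And>z. z \<in> {0..1} \<Longrightarrow> v z = (1 - z) * y z"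
    and d: "\<And>z w. z \<in> {0..1} \<Longrightarrow> w \<in> {0..1} \<Longrightarrow> v z - v w = (z - w) * d z w"
    and pu: "\<And>z. z \<in> {0..1} \<Longrightarrow> 0 < 1 + t * u z"
    and py: "\<And>z. z \<in> {0..1} \<Longrightarrow> 0 < 1 - t * y z"
    and pd: "\<And>z w. z \<in> {0..1} \<Longrightarrow> w \<in> {0..1} \<Longrightarrow> 0 < 1 + t * d z w"
  shows "(\<Prod>i<n. 1 + t * d (x i) (x i)) * selberg_weight n a b c (\<lambda>i\<in>{..<n}. x i + t * v (x i))
     = selberg_weight n a b c x * exp (log_jacobian n a b c d u y t x)"
proof -
  have exp_powr: "exp (e * ln z) = z powr e" if "0 < z" for e z :: real
    using that by (simp add: powr_def)
  have "(\<Prod>i<n. \<Prod>j\<in>{..<n} - {i}. \<bar>(x i + t * v (x i)) - (x j + t * v (x j))\<bar> powr c)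
     = (\<Prod>i<n. \<Prod>j\<in>{..<n} - {i}. \<bar>x i - x j\<bar> powr c * (1 + t * d (x i) (x j)) powr c)"
  proof (intro prod.cong refl)
    fix i j assume "i \<in> {..<n}" "j \<in> {..<n} - {i}"
    then have ij: "x i \<in> {0..1}" "x j \<in> {0..1}" using x by auto
    have "(x i + t * v (x i)) - (x j + t * v (x j)) = (x i - x j) + t * (v (x i) - v (x j))"
      by (simp add: algebra_simps)
    also have "\<dots> = (x i - x j) * (1 + t * d (x i) (x j))"
      by (simp only: d[OF ij]) (simp add: algebra_simps)
    finally show "\<bar>(x i + t * v (x i)) - (x j + t * v (x j))\<bar> powr c
        = \<bar>x i - x j\<bar> powr c * (1 + t * d (x i) (x j)) powr c"
      using pd[OF ij] by (simp add: abs_mult powr_mult)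
  qed
  moreover have "(\<Prod>i<n. (x i + t * v (x i)) powr (a i - 1))
     = (\<Prod>i<n. x i powr (a i - 1) * (1 + t * u (x i)) powr (a i - 1))"
  proof (intro prod.cong refl)
    fix i assume "i \<in> {..<n}"
    then have i: "x i \<in> {0..1}" using x by auto
    have "x i + t * v (x i) = x i * (1 + t * u (x i))"
      using u[OF i] by (simp add: algebra_simps)
    then show "(x i + t * v (x i)) powr (a i - 1) = x i powr (a i - 1) * (1 + t * u (x i)) powr (a i - 1)"
      using pu[OF i] i by (simp add: powr_mult)
  qed
  moreover have "(\<Prod>i<n. (1 - (x i + t * v (x i))) powr (b - 1))
     = (\<Prod>i<n. (1 - x i) powr (b - 1) * (1 - t * y (x i)) powr (b - 1))"
  proof (intro prod.cong refl)
    fix i assume "i \<in> {..<n}"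
    then have i: "x i \<in> {0..1}" using x by auto
    have "1 - (x i + t * v (x i)) = (1 - x i) * (1 - t * y (x i))"
      by (simp only: y[OF i]) (simp add: algebra_simps)
    then show "(1 - (x i + t * v (x i))) powr (b - 1) = (1 - x i) powr (b - 1) * (1 - t * y (x i)) powr (b - 1)"
      using py[OF i] i by (simp add: powr_mult)
  qed
  ultimately have W: "selberg_weight n a b c (\<lambda>i\<in>{..<n}. x i + t * v (x i)) =
     selberg_weight n a b c x *
       ((\<Prod>i<n. \<Prod>j\<in>{..<n} - {i}. (1 + t * d (x i) (x j)) powr c) *
        (\<Prod>i<n. (1 + t * u (x i)) powr (a i - 1)) * (\<Prod>i<n. (1 - t * y (x i)) powr (b - 1)))"
    by (simp add: selberg_weight_def prod.distrib)
  have "exp (\<Sum>i<n. \<Sum>j<n. (if i = j then 1 else c) * ln (1 + t * d (x i) (x j)))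
     = (\<Prod>i<n. \<Prod>j<n. (1 + t * d (x i) (x j)) powr (if i = j then 1 else c))"
    using pd x by (simp add: exp_sum exp_powr)
  also have "\<dots> = (\<Prod>i<n. (1 + t * d (x i) (x i)) * (\<Prod>j\<in>{..<n} - {i}. (1 + t * d (x i) (x j)) powr c))"
  proof (intro prod.cong refl)
    fix i assume i: "i \<in> {..<n}"
    have "(\<Prod>j<n. (1 + t * d (x i) (x j)) powr (if i = j then 1 else c))
       = (1 + t * d (x i) (x i)) powr (if i = i then 1 else c) *
         (\<Prod>j\<in>{..<n} - {i}. (1 + t * d (x i) (x j)) powr (if i = j then 1 else c))"
      using i by (intro prod.remove) auto
    also have "(\<Prod>j\<in>{..<n} - {i}. (1 + t * d (x i) (x j)) powr (if i = j then 1 else c))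
       = (\<Prod>j\<in>{..<n} - {i}. (1 + t * d (x i) (x j)) powr c)"
      by (intro prod.cong) auto
    finally show "(\<Prod>j<n. (1 + t * d (x i) (x j)) powr (if i = j then 1 else c))
       = (1 + t * d (x i) (x i)) * (\<Prod>j\<in>{..<n} - {i}. (1 + t * d (x i) (x j)) powr c)"
      using pd[OF x x, of i i] i by simp
  qed
  finally have "exp (\<Sum>i<n. \<Sum>j<n. (if i = j then 1 else c) * ln (1 + t * d (x i) (x j)))
     = (\<Prod>i<n. 1 + t * d (x i) (x i)) * (\<Prod>i<n. \<Prod>j\<in>{..<n} - {i}. (1 + t * d (x i) (x j)) powr c)"
    by (simp add: prod.distrib)
  moreover have "exp (\<Sum>i<n. (a i - 1) * ln (1 + t * u (x i)) + (b - 1) * ln (1 - t * y (x i)))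
     = (\<Prod>i<n. (1 + t * u (x i)) powr (a i - 1)) * (\<Prod>i<n. (1 - t * y (x i)) powr (b - 1))"
    using pu py x by (simp add: exp_sum exp_add exp_powr prod.distrib)
  ultimately show ?thesis
    unfolding W log_jacobian_def by (simp add: exp_add)
qed

section \<open>Bounds and derivative of the logarithmic Jacobian\<close>

lemma abs_ln_one_plus_le:
  fixes z :: real
  assumes "\<bar>z\<bar> \<le> 1/2"
  shows "\<bar>ln (1 + z)\<bar> \<le> 2 * \<bar>z\<bar>"
proof -
  have "\<bar>ln (1 + z) - z\<bar> \<le> 2 * z\<^sup>2"
    using assms by (rule abs_ln_one_plus_x_minus_x_bound)
  moreover have "2 * z\<^sup>2 \<le> \<bar>z\<bar>"
  proof -
    have "\<bar>z\<bar> * \<bar>z\<bar> \<le> 1/2 * \<bar>z\<bar>" using assms by (intro mult_right_mono) auto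
    then show ?thesis by (simp add: power2_eq_square flip: abs_mult)
  qed
  ultimately show ?thesis by linarith
qed

text \<open>Both signs follow from \<open>1 + s \<le> exp s\<close>, applied to \<open>- s\<close>
  when \<open>s\<close> is nonnegative and to \<open>s\<close> otherwise.\<close>

lemma abs_exp_minus_one_le: "\<bar>exp s - 1\<bar> \<le> \<bar>s\<bar> * exp \<bar>s\<bar>" for s :: real
proof (cases "s \<ge> 0")
  case True
  have "1 - s \<le> exp (- s)" using exp_ge_add_one_self[of "-s"] by simp
  then have "(1 - s) * exp s \<le> exp (- s) * exp s" by (intro mult_right_mono) auto
  then have "exp s - 1 \<le> s * exp s" by (simp add: algebra_simps flip: exp_add)
  then show ?thesis using True by simp
next
  case False
  then have "\<bar>exp s - 1\<bar> = 1 - exp s" by simp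
  also have "\<dots> \<le> \<bar>s\<bar> * 1" using exp_ge_add_one_self[of s] False by linarith
  also have "\<dots> \<le> \<bar>s\<bar> * exp \<bar>s\<bar>" by (intro mult_left_mono) auto
  finally show ?thesis .
qed

text \<open>The bound is linear in \<open>t\<close> and uniform in \<open>x\<close>, so it survives
  division by \<open>t\<close>. The condition \<open>t * K \<le> 1/2\<close> keeps the arguments of
  all logarithms between 1/2 and 3/2.\<close>

lemma abs_log_jacobian_le:
  fixes t K :: real
  assumes x: "\<And>i. i < n \<Longrightarrow> x i \<in> {0..1::real}"
    and bu: "\<And>z. z \<in> {0..1} \<Longrightarrow> \<bar>u z\<bar> \<le> K"
    and by': "\<And>z. z \<in> {0..1} \<Longrightarrow> \<bar>y z\<bar> \<le> K"
    and bd: "\<And>z w. z \<in> {0..1} \<Longrightarrow> w \<in> {0..1} \<Longrightarrow> \<bar>d z w\<bar> \<le> K"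
    and t: "0 \<le> t" "t * K \<le> 1/2"
  shows "\<bar>log_jacobian n a b c d u y t x\<bar> \<le> t * (2 * K *
           ((\<Sum>i<n. \<Sum>j<n. \<bar>if i = j then 1 else c\<bar>) + (\<Sum>i<n. \<bar>a i - 1\<bar> + \<bar>b - 1\<bar>)))"
proof -
  have ln: "\<bar>e * ln (1 + t * z)\<bar> \<le> \<bar>e\<bar> * (2 * (t * K))" if "\<bar>z\<bar> \<le> K" for e z
  proof -
    have tz: "\<bar>t * z\<bar> \<le> t * K" using that t by (simp add: abs_mult mult_left_mono)
    then have "\<bar>ln (1 + t * z)\<bar> \<le> 2 * \<bar>t * z\<bar>" using t by (intro abs_ln_one_plus_le) linarith
    then have "\<bar>ln (1 + t * z)\<bar> \<le> 2 * (t * K)" using tz by linarith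
    then show ?thesis by (simp add: abs_mult mult_left_mono)
  qed
  have ln': "\<bar>e * ln (1 - t * z)\<bar> \<le> \<bar>e\<bar> * (2 * (t * K))" if "\<bar>z\<bar> \<le> K" for e z
    using ln[of "- z" e] that by simp
  have "\<bar>\<Sum>i<n. \<Sum>j<n. (if i = j then 1 else c) * ln (1 + t * d (x i) (x j))\<bar>
     \<le> (\<Sum>i<n. \<Sum>j<n. \<bar>if i = j then 1 else c\<bar> * (2 * (t * K)))"
    using bd x by (intro order_trans[OF sum_abs] sum_mono ln) auto
  moreover have "\<bar>\<Sum>i<n. (a i - 1) * ln (1 + t * u (x i)) + (b - 1) * ln (1 - t * y (x i))\<bar>
     \<le> (\<Sum>i<n. \<bar>a i - 1\<bar> * (2 * (t * K)) + \<bar>b - 1\<bar> * (2 * (t * K)))"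
    using bu by' x
    by (intro order_trans[OF sum_abs] sum_mono order_trans[OF abs_triangle_ineq] add_mono ln ln') auto
  ultimately have "\<bar>log_jacobian n a b c d u y t x\<bar>
     \<le> (\<Sum>i<n. \<Sum>j<n. \<bar>if i = j then 1 else c\<bar> * (2 * (t * K)))
       + (\<Sum>i<n. \<bar>a i - 1\<bar> * (2 * (t * K)) + \<bar>b - 1\<bar> * (2 * (t * K)))"
    unfolding log_jacobian_def by linarith
  also have "\<dots> = t * (2 * K *
           ((\<Sum>i<n. \<Sum>j<n. \<bar>if i = j then 1 else c\<bar>) + (\<Sum>i<n. \<bar>a i - 1\<bar> + \<bar>b - 1\<bar>)))"
    by (simp only: sum_distrib_right[symmetric] distrib_right[symmetric]) (simp only: mult_ac)
  finally show ?thesis .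
qed

text \<open>At \<open>t = 0\<close> all logarithms vanish, so the exponential is 1 there and only
  the derivative of the exponent remains.\<close>

lemma has_real_derivative_exp_log_jacobian:
  "((\<lambda>t. exp (log_jacobian n a b c d u y t x)) has_real_derivative weight_divergence n a b c d u y x) (at 0)"
proof -
  have ln: "((\<lambda>t. ln (1 + t * z)) has_real_derivative z) (at 0)" for z :: real
    by (auto intro!: derivative_eq_intros)
  have ln': "((\<lambda>t. ln (1 - t * z)) has_real_derivative - z) (at 0)" for z :: real
    by (auto intro!: derivative_eq_intros)
  have "((\<lambda>t. log_jacobian n a b c d u y t x) has_real_derivative
     (\<Sum>i<n. \<Sum>j<n. (if i = j then 1 else c) * d (x i) (x j)) +
     (\<Sum>i<n. (a i - 1) * u (x i) + (b - 1) * (- y (x i)))) (at 0)"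
    unfolding log_jacobian_def
    by (intro DERIV_add DERIV_sum DERIV_cmult ln ln')
  from DERIV_fun_exp[OF this] show ?thesis
    by (simp add: log_jacobian_def weight_divergence_def)
qed

lemma
  assumes mu: "u \<in> borel_measurable borel" and my: "y \<in> borel_measurable borel"
    and md: "(\<lambda>p. d (fst p) (snd p)) \<in> borel_measurable (borel \<Otimes>\<^sub>M borel)"
  shows measurable_log_jacobian: "log_jacobian n a b c d u y t \<in> borel_measurable (jacobi_measure n)"
    and measurable_weight_divergence:
      "weight_divergence n a b c d u y \<in> borel_measurable (jacobi_measure n)"
proof -
  have "(\<lambda>x. d (x i) (x j)) \<in> borel_measurable (jacobi_measure n)" if "i < n" "j < n" for i j
  proof -
    have "(\<lambda>x. (x i, x j)) \<in> measurable (jacobi_measure n) (borel \<Otimes>\<^sub>M borel)"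
      using that by measurable
    from measurable_compose[OF this md] show ?thesis by simp
  qed
  moreover have "(\<lambda>x. u (x i)) \<in> borel_measurable (jacobi_measure n)"
    "(\<lambda>x. y (x i)) \<in> borel_measurable (jacobi_measure n)" if "i < n" for i
    using that mu my by measurable
  ultimately show "log_jacobian n a b c d u y t \<in> borel_measurable (jacobi_measure n)"
    "weight_divergence n a b c d u y \<in> borel_measurable (jacobi_measure n)"
    unfolding log_jacobian_def[abs_def] weight_divergence_def[abs_def]
    by (intro borel_measurable_add borel_measurable_sum borel_measurable_times borel_measurable_const
        borel_measurable_ln borel_measurable_diff; auto)+
qed

text \<open>The substitution leaves the integral of the weight unchanged for each small
  \<open>t\<close>, so the weighted difference quotients in \<open>t\<close> integrate to 0. They
  are dominated by a constant multiple of the weight, hence their limit at \<open>t = 0\<close> also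
  integrates to 0.\<close>

lemma integral_weight_divergence:
  fixes v u y :: "real \<Rightarrow> real" and d :: "real \<Rightarrow> real \<Rightarrow> real"
  assumes int: "integrable (jacobi_measure n) (selberg_weight n a b c)"
    and u: "\<And>z. z \<in> {0..1} \<Longrightarrow> v z = z * u z"
    and y: "\<And>z. z \<in> {0..1} \<Longrightarrow> v z = (1 - z) * y z"
    and d: "\<And>z w. z \<in> {0..1} \<Longrightarrow> w \<in> {0..1} \<Longrightarrow> v z - v w = (z - w) * d z w"
    and deriv: "\<And>z. z \<in> {0..1} \<Longrightarrow> (v has_real_derivative d z z) (at z)"
    and cont: "continuous_on {0..1} (\<lambda>z. d z z)"
    and bu: "\<And>z. z \<in> {0..1} \<Longrightarrow> \<bar>u z\<bar> \<le> K"
    and by': "\<And>z. z \<in> {0..1} \<Longrightarrow> \<bar>y z\<bar> \<le> K"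
    and bd: "\<And>z w. z \<in> {0..1} \<Longrightarrow> w \<in> {0..1} \<Longrightarrow> \<bar>d z w\<bar> \<le> K"
    and mu [measurable]: "u \<in> borel_measurable borel"
    and my [measurable]: "y \<in> borel_measurable borel"
    and md [measurable]: "(\<lambda>p. d (fst p) (snd p)) \<in> borel_measurable (borel \<Otimes>\<^sub>M borel)"
  shows "(\<integral>x. selberg_weight n a b c x * weight_divergence n a b c d u y x \<partial>jacobi_measure n) = 0"
proof -
  let ?M = "jacobi_measure n"
  let ?W = "selberg_weight n a b c"
  let ?S = "log_jacobian n a b c d u y"
  let ?E = "weight_divergence n a b c d u y"
  define L where "L = 2 * K *
           ((\<Sum>i<n. \<Sum>j<n. \<bar>if i = j then 1 else c\<bar>) + (\<Sum>i<n. \<bar>a i - 1\<bar> + \<bar>b - 1\<bar>))"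
  have K: "0 \<le> K" using bu[of 0] by simp
  have L: "0 \<le> L" unfolding L_def using K by (intro mult_nonneg_nonneg add_nonneg_nonneg sum_nonneg) auto
  \<comment> \<open>A null sequence of admissible parameters: the summand \<open>2 * K\<close>
    ensures \<open>t k * K \<le> 1/2\<close>, and the summand 1 ensures \<open>t k \<le> 1\<close>
    and positivity even when \<open>K = 0\<close>.\<close>
  define t where "t k = inverse (real k + (2 * K + 1))" for k
  have t0: "0 < t k" and t1: "t k \<le> 1" and tK: "t k * K \<le> 1/2" for k
    using K by (simp_all add: t_def field_simps)
  note [measurable] = measurable_log_jacobian[OF mu my md] measurable_weight_divergence[OF mu my md]
  have bnd: "\<bar>(exp (?S (t k) x) - 1) / t k\<bar> \<le> L * exp L" if x: "x \<in> space ?M" for k x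
  proof -
    have S: "\<bar>?S (t k) x\<bar> \<le> t k * L"
      unfolding L_def
      by (rule abs_log_jacobian_le[OF space_jacobi_measure[OF x] bu by' bd]) (use t0[of k] tK in auto)
    also have "\<dots> \<le> L" using t1[of k] t0[of k] L by (simp add: mult_left_le_one_le)
    finally have "\<bar>?S (t k) x\<bar> * exp \<bar>?S (t k) x\<bar> \<le> (t k * L) * exp L"
      using S L t0[of k] by (intro mult_mono) auto
    then have "\<bar>exp (?S (t k) x) - 1\<bar> \<le> t k * (L * exp L)"
      using abs_exp_minus_one_le[of "?S (t k) x"] by (simp add: mult.assoc)
    then show ?thesis using t0[of k] by (simp add: abs_divide divide_le_eq mult.commute)
  qed
  have bndW: "norm (?W x * ((exp (?S (t k) x) - 1) / t k)) \<le> ?W x * (L * exp L)"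
    if "x \<in> space ?M" for k x
    unfolding real_norm_def abs_mult abs_of_nonneg[OF selberg_weight_nonneg]
    by (intro mult_left_mono bnd that selberg_weight_nonneg)
  have zero: "(\<integral>x. ?W x * ((exp (?S (t k) x) - 1) / t k) \<partial>?M) = 0" for k
  proof -
    have small: "\<bar>t k * z\<bar> \<le> 1/2" if "\<bar>z\<bar> \<le> K" for z
    proof -
      have "\<bar>t k * z\<bar> \<le> t k * K" using that t0[of k] by (simp add: abs_mult)
      then show ?thesis using tK[of k] by linarith
    qed
    have pu: "0 < 1 + t k * u z" if "z \<in> {0..1}" for z
      using small[OF bu[OF that]] by linarith
    have py: "0 < 1 - t k * y z" if "z \<in> {0..1}" for z
      using small[OF by'[OF that]] by linarith
    have pd: "0 < 1 + t k * d z w" if "z \<in> {0..1}" "w \<in> {0..1}" for z w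
      using small[OF bd[OF that]] by linarith
    let ?g = "\<lambda>z. z + t k * v z"
    have "(\<integral>x. (\<Prod>i<n. 1 + t k * d (x i) (x i)) * ?W (\<lambda>i\<in>{..<n}. ?g (x i)) \<partial>?M) = (\<integral>x. ?W x \<partial>?M)"
      unfolding jacobi_measure_def
    proof (rule unit_product_integral_substitution[where g = ?g and g' = "\<lambda>z. 1 + t k * d z z"])
      show "(?g has_real_derivative 1 + t k * d z z) (at z)" if "z \<in> {0..1}" for z
        using deriv[OF that] by (auto intro!: derivative_eq_intros)
      show "continuous_on {0..1} (\<lambda>z. 1 + t k * d z z)"
        by (intro continuous_intros cont)
      show "0 \<le> 1 + t k * d z z" if "z \<in> {0..1}" for z
        using pd[OF that that] by simp
      show "?g 0 = 0" using u[of 0] by simp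
      show "?g 1 = 1" using y[of 1] by simp
      \<comment> \<open>The form \<open>z * u z\<close> keeps the image above 0, the form
        \<open>(1 - z) * y z\<close> keeps it below 1.\<close>
      show "?g z \<in> {0..1}" if z: "z \<in> {0..1}" for z
      proof -
        have "?g z = z * (1 + t k * u z)" using u[OF z] by (simp add: algebra_simps)
        moreover have "1 - ?g z = (1 - z) * (1 - t k * y z)" by (simp only: y[OF z]) (simp add: algebra_simps)
        ultimately have "0 \<le> ?g z" "0 \<le> 1 - ?g z"
          using z pu[OF z] py[OF z] by (auto intro: mult_nonneg_nonneg)
        then show ?thesis by simp
      qed
      show "?W \<in> borel_measurable (PiM {..<n} (\<lambda>_. unit_lborel))"
        using measurable_selberg_weight unfolding jacobi_measure_def .
    qed simp
    also have "(\<integral>x. (\<Prod>i<n. 1 + t k * d (x i) (x i)) * ?W (\<lambda>i\<in>{..<n}. ?g (x i)) \<partial>?M)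
        = (\<integral>x. ?W x * exp (?S (t k) x) \<partial>?M)"
      by (intro Bochner_Integration.integral_cong refl selberg_weight_perturb[OF _ u y d pu py pd])
        (auto dest: space_jacobi_measure)
    finally have eq: "(\<integral>x. ?W x * exp (?S (t k) x) \<partial>?M) = (\<integral>x. ?W x \<partial>?M)" .
    have "integrable ?M (\<lambda>x. ?W x * ((exp (?S (t k) x) - 1) / t k))"
    proof (rule Bochner_Integration.integrable_bound[where f = "\<lambda>x. ?W x * (L * exp L)"])
      show "AE x in ?M. norm (?W x * ((exp (?S (t k) x) - 1) / t k)) \<le> norm (?W x * (L * exp L))"
        using order_trans[OF bndW abs_ge_self] by (intro AE_I2) simp
    qed (use int in auto)
    \<comment> \<open>Integrability of the transformed weight is recovered from that of the
      difference quotient, which has just been bounded.\<close>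
    then have "integrable ?M (\<lambda>x. t k * (?W x * ((exp (?S (t k) x) - 1) / t k)) + ?W x)"
      by (intro Bochner_Integration.integrable_add integrable_mult_right int)
    also have "(\<lambda>x. t k * (?W x * ((exp (?S (t k) x) - 1) / t k)) + ?W x) = (\<lambda>x. ?W x * exp (?S (t k) x))"
      using t0[of k] by (auto simp: field_simps)
    finally have int': "integrable ?M (\<lambda>x. ?W x * exp (?S (t k) x))" .
    have "(\<integral>x. ?W x * ((exp (?S (t k) x) - 1) / t k) \<partial>?M)
        = (\<integral>x. (?W x * exp (?S (t k) x) - ?W x) / t k \<partial>?M)"
      by (intro Bochner_Integration.integral_cong) (auto simp: field_simps)
    also have "\<dots> = 0"
      using int int' eq by simp
    finally show ?thesis .
  qed
  have lim: "(\<lambda>k. (exp (?S (t k) x) - 1) / t k) \<longlonglongrightarrow> ?E x" for x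
  proof -
    have "t \<longlonglongrightarrow> 0"
      unfolding t_def
      by (rule tendsto_inverse_0_at_top) (auto intro!: filterlim_tendsto_add_at_top filterlim_real_sequentially
          simp: add.commute[of "real _"])
    then have "filterlim t (at 0) sequentially"
      using t0 by (auto simp: filterlim_at less_imp_neq[THEN not_sym] intro!: always_eventually)
    moreover have "((\<lambda>h. (exp (?S h x) - 1) / h) \<longlongrightarrow> ?E x) (at 0)"
      using has_real_derivative_exp_log_jacobian[of n a b c d u y x]
      by (simp add: DERIV_def log_jacobian_def)
    ultimately show ?thesis
      by (rule filterlim_compose[rotated])
  qed
  have "(\<lambda>k. \<integral>x. ?W x * ((exp (?S (t k) x) - 1) / t k) \<partial>?M) \<longlonglongrightarrow> (\<integral>x. ?W x * ?E x \<partial>?M)"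
  proof (rule integral_dominated_convergence[where w = "\<lambda>x. ?W x * (L * exp L)"])
    show "AE x in ?M. (\<lambda>k. ?W x * ((exp (?S (t k) x) - 1) / t k)) \<longlonglongrightarrow> ?W x * ?E x"
      by (intro AE_I2 tendsto_mult lim tendsto_const)
    show "AE x in ?M. norm (?W x * ((exp (?S (t k) x) - 1) / t k)) \<le> ?W x * (L * exp L)" for k
      by (intro AE_I2 bndW)
  qed (use int in auto)
  then have "(\<lambda>k::nat. 0) \<longlonglongrightarrow> (\<integral>x. ?W x * ?E x \<partial>?M)"
    by (simp only: zero)
  then show ?thesis
    using LIMSEQ_unique tendsto_const by blast
qed

subsection \<open>Vector fields that do not vanish at the origin\<close>

text \<open>This holds for negative exponents too, because \<open>0 powr e = 0\<close> for every
  \<open>e\<close>. Points where a later formula divides by a zero coordinate are thereby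
  harmless.\<close>

lemma selberg_weight_eq_0: "i < n \<Longrightarrow> x i = 0 \<Longrightarrow> selberg_weight n a b c x = 0"
  unfolding selberg_weight_def by (auto simp: prod_zero_iff)

text \<open>Dominated convergence along a sequence of fields. Limits and bounds are required on
  \<open>{0<..1}\<close> only, since the weight vanishes as soon as one coordinate is 0. The
  majorants \<open>p\<close> and \<open>q\<close> may blow up at the origin, so their integrability
  against the weight is a hypothesis.\<close>

lemma integral_weight_divergence_limit:
  fixes u y :: "nat \<Rightarrow> real \<Rightarrow> real" and d :: "nat \<Rightarrow> real \<Rightarrow> real \<Rightarrow> real"
  assumes zero: "\<And>k. (\<integral>x. selberg_weight n a b c x * weight_divergence n a b c (d k) (u k) (y k) x
                   \<partial>jacobi_measure n) = 0"
    and meas: "\<And>k. weight_divergence n a b c (d k) (u k) (y k) \<in> borel_measurable (jacobi_measure n)"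
      "weight_divergence n a b c d0 u0 y0 \<in> borel_measurable (jacobi_measure n)"
    and lu: "\<And>z. z \<in> {0<..1} \<Longrightarrow> (\<lambda>k. u k z) \<longlonglongrightarrow> u0 z"
    and ly: "\<And>z. z \<in> {0<..1} \<Longrightarrow> (\<lambda>k. y k z) \<longlonglongrightarrow> y0 z"
    and ld: "\<And>z w. z \<in> {0<..1} \<Longrightarrow> w \<in> {0<..1} \<Longrightarrow> (\<lambda>k. d k z w) \<longlonglongrightarrow> d0 z w"
    and bu: "\<And>k z. z \<in> {0<..1} \<Longrightarrow> \<bar>u k z\<bar> \<le> p z"
    and by': "\<And>k z. z \<in> {0<..1} \<Longrightarrow> \<bar>y k z\<bar> \<le> p z"
    and bd: "\<And>k z w. z \<in> {0<..1} \<Longrightarrow> w \<in> {0<..1} \<Longrightarrow> \<bar>d k z w\<bar> \<le> q z w"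
    and ip: "\<And>i. i < n \<Longrightarrow> integrable (jacobi_measure n) (\<lambda>x. selberg_weight n a b c x * p (x i))"
    and iq: "\<And>i j. i < n \<Longrightarrow> j < n \<Longrightarrow>
               integrable (jacobi_measure n) (\<lambda>x. selberg_weight n a b c x * q (x i) (x j))"
  shows "(\<integral>x. selberg_weight n a b c x * weight_divergence n a b c d0 u0 y0 x \<partial>jacobi_measure n) = 0"
proof -
  let ?M = "jacobi_measure n"
  let ?W = "selberg_weight n a b c"
  let ?E = "\<lambda>k. weight_divergence n a b c (d k) (u k) (y k)"
  let ?F = "weight_divergence n a b c d0 u0 y0"
  let ?B = "\<lambda>x. (\<Sum>i<n. \<Sum>j<n. \<bar>if i = j then 1 else c\<bar> * (?W x * q (x i) (x j))) +
     (\<Sum>i<n. (\<bar>a i - 1\<bar> + \<bar>b - 1\<bar>) * (?W x * p (x i)))"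
  have cases: "?W x = 0 \<or> (\<forall>i<n. x i \<in> {0<..1})" if "x \<in> space ?M" for x
    using that selberg_weight_eq_0[of _ n x a b c] space_jacobi_measure[OF that]
    by (metis atLeastAtMost_iff greaterThanAtMost_iff order_le_less)
  have "(\<lambda>k. \<integral>x. ?W x * ?E k x \<partial>?M) \<longlonglongrightarrow> (\<integral>x. ?W x * ?F x \<partial>?M)"
  proof (rule integral_dominated_convergence[where w = ?B])
    show "integrable ?M ?B"
      by (intro Bochner_Integration.integrable_add Bochner_Integration.integrable_sum
          Bochner_Integration.integrable_mult_right iq ip) auto
    show "AE x in ?M. (\<lambda>k. ?W x * ?E k x) \<longlonglongrightarrow> ?W x * ?F x"
    proof (rule AE_I2)
      fix x assume "x \<in> space ?M"
      from cases[OF this] show "(\<lambda>k. ?W x * ?E k x) \<longlonglongrightarrow> ?W x * ?F x"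
      proof
        assume "\<forall>i<n. x i \<in> {0<..1}"
        then show ?thesis
          unfolding weight_divergence_def
          by (intro tendsto_mult tendsto_add tendsto_sum tendsto_diff tendsto_const lu ly ld) auto
      qed simp
    qed
    show "AE x in ?M. norm (?W x * ?E k x) \<le> ?B x" for k
    proof (rule AE_I2)
      fix x assume "x \<in> space ?M"
      from cases[OF this] show "norm (?W x * ?E k x) \<le> ?B x"
      proof
        assume x: "\<forall>i<n. x i \<in> {0<..1}"
        have "\<bar>\<Sum>i<n. \<Sum>j<n. (if i = j then 1 else c) * d k (x i) (x j)\<bar>
           \<le> (\<Sum>i<n. \<Sum>j<n. \<bar>if i = j then 1 else c\<bar> * q (x i) (x j))"
          using x by (intro order_trans[OF sum_abs] sum_mono)
            (simp only: abs_mult, intro mult_left_mono bd abs_ge_zero, auto)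
        moreover have "\<bar>\<Sum>i<n. (a i - 1) * u k (x i) - (b - 1) * y k (x i)\<bar>
           \<le> (\<Sum>i<n. (\<bar>a i - 1\<bar> + \<bar>b - 1\<bar>) * p (x i))"
        proof (intro order_trans[OF sum_abs] sum_mono)
          fix i assume "i \<in> {..<n}"
          then have "\<bar>u k (x i)\<bar> \<le> p (x i)" "\<bar>y k (x i)\<bar> \<le> p (x i)"
            using x bu by' by auto
          then have "\<bar>a i - 1\<bar> * \<bar>u k (x i)\<bar> + \<bar>b - 1\<bar> * \<bar>y k (x i)\<bar> \<le> \<bar>a i - 1\<bar> * p (x i) + \<bar>b - 1\<bar> * p (x i)"
            by (intro add_mono mult_left_mono) auto
          then show "\<bar>(a i - 1) * u k (x i) - (b - 1) * y k (x i)\<bar> \<le> (\<bar>a i - 1\<bar> + \<bar>b - 1\<bar>) * p (x i)"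
            using abs_triangle_ineq4[of "(a i - 1) * u k (x i)" "(b - 1) * y k (x i)"]
            by (simp add: abs_mult distrib_right)
        qed
        ultimately have "\<bar>?E k x\<bar> \<le> (\<Sum>i<n. \<Sum>j<n. \<bar>if i = j then 1 else c\<bar> * q (x i) (x j)) +
            (\<Sum>i<n. (\<bar>a i - 1\<bar> + \<bar>b - 1\<bar>) * p (x i))"
          unfolding weight_divergence_def by linarith
        then have "?W x * \<bar>?E k x\<bar> \<le> ?W x * ((\<Sum>i<n. \<Sum>j<n. \<bar>if i = j then 1 else c\<bar> * q (x i) (x j)) +
            (\<Sum>i<n. (\<bar>a i - 1\<bar> + \<bar>b - 1\<bar>) * p (x i)))"
          by (rule mult_left_mono[OF _ selberg_weight_nonneg])
        also have "\<dots> = ?B x"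
          by (simp only: distrib_left sum_distrib_left mult.left_commute)
        finally show ?thesis
          by (simp add: abs_mult selberg_weight_nonneg)
      qed simp
    qed
  qed (use meas in auto)
  then have "(\<lambda>k::nat. 0) \<longlonglongrightarrow> (\<integral>x. ?W x * ?F x \<partial>?M)"
    by (simp only: zero)
  then show ?thesis
    using LIMSEQ_unique tendsto_const by blast
qed

text \<open>With \<open>s = z + e\<close> the field \<open>z * (1 - z) / (z + e)\<close> reads
  \<open>1 + 2 * e - s - e * (1 + e) / s\<close>, which explains the divided difference. For fixed
  \<open>e\<close> all quotients are bounded, as the substitution argument requires.\<close>

lemma integral_divergence_shifted_unit_field:
  fixes e :: real
  assumes int: "integrable (jacobi_measure n) (selberg_weight n a b c)" and e: "0 < e" "e \<le> 1"
  shows "(\<integral>x. selberg_weight n a b c x * weight_divergence n a b c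
            (\<lambda>z w. e * (1 + e) / ((z + e) * (w + e)) - 1) (\<lambda>z. (1 - z) / (z + e)) (\<lambda>z. z / (z + e)) x
           \<partial>jacobi_measure n) = 0"
proof (rule integral_weight_divergence[OF int, where v = "\<lambda>z. z * (1 - z) / (z + e)" and K = "3 / e"])
  have pos: "0 < z + e" if "z \<in> {0..1}" for z
    using that e by auto
  show "z * (1 - z) / (z + e) - w * (1 - w) / (w + e) = (z - w) * (e * (1 + e) / ((z + e) * (w + e)) - 1)"
    if "z \<in> {0..1}" "w \<in> {0..1}" for z w
    using pos[OF that(1)] pos[OF that(2)] by (simp add: divide_simps) algebra
  show "((\<lambda>z. z * (1 - z) / (z + e)) has_real_derivative e * (1 + e) / ((z + e) * (z + e)) - 1) (at z)"
    if "z \<in> {0..1}" for z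
    using pos[OF that] by (auto intro!: derivative_eq_intros simp: divide_simps) algebra
  show "continuous_on {0..1} (\<lambda>z. e * (1 + e) / ((z + e) * (z + e)) - 1)"
    by (intro continuous_intros) (use pos in force)
  show "\<bar>(1 - z) / (z + e)\<bar> \<le> 3 / e" if "z \<in> {0..1}" for z
    using that e pos[OF that] by (simp add: abs_divide) (intro frac_le, auto)
  show "\<bar>z / (z + e)\<bar> \<le> 3 / e" if "z \<in> {0..1}" for z
    using that e pos[OF that] by (simp add: abs_divide) (intro frac_le, auto)
  show "\<bar>e * (1 + e) / ((z + e) * (w + e)) - 1\<bar> \<le> 3 / e" if zw: "z \<in> {0..1}" "w \<in> {0..1}" for z w
  proof -
    \<comment> \<open>The constant \<open>3 / e\<close> is \<open>2 / e\<close> from this term plus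
      \<open>1 / e\<close>, which dominates the remaining 1 because
      \<open>e \<le> 1\<close>.\<close>
    have "e * (1 + e) / ((z + e) * (w + e)) \<le> e * 2 / (e * e)"
      using zw e by (intro frac_le mult_mono mult_pos_pos) auto
    also have "\<dots> = 2 / e" using e by simp
    finally have "e * (1 + e) / ((z + e) * (w + e)) \<le> 2 / e" .
    moreover have "0 \<le> e * (1 + e) / ((z + e) * (w + e))" using zw e by simp
    moreover have "1 \<le> 1 / e" "3 / e = 2 / e + 1 / e" using e by (simp_all add: field_simps)
    ultimately show ?thesis by linarith
  qed
qed (use e in \<open>auto\<close>)

text \<open>With \<open>s = z + e\<close> the field \<open>z * (1 - z) / (z + e)\<^sup>2\<close>
  reads \<open>(1 + 2 * e) / s - 1 - e * (1 + e) / s\<^sup>2\<close>. The two terms of the divided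
  difference come from \<open>1 / s\<^sup>2\<close> and \<open>1 / s\<close> respectively.\<close>

lemma integral_divergence_shifted_inverse_field:
  fixes e :: real
  assumes int: "integrable (jacobi_measure n) (selberg_weight n a b c)" and e: "0 < e" "e \<le> 1"
  shows "(\<integral>x. selberg_weight n a b c x * weight_divergence n a b c
            (\<lambda>z w. e * (1 + e) * ((z + e) + (w + e)) / ((z + e)\<^sup>2 * (w + e)\<^sup>2) - (1 + 2 * e) / ((z + e) * (w + e)))
            (\<lambda>z. (1 - z) / (z + e)\<^sup>2) (\<lambda>z. z / (z + e)\<^sup>2) x
           \<partial>jacobi_measure n) = 0"
proof (rule integral_weight_divergence[OF int, where v = "\<lambda>z. z * (1 - z) / (z + e)\<^sup>2" and K = "7 / e\<^sup>2 + 8 / e ^ 4"])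
  let ?d = "\<lambda>z w. e * (1 + e) * ((z + e) + (w + e)) / ((z + e)\<^sup>2 * (w + e)\<^sup>2) - (1 + 2 * e) / ((z + e) * (w + e))"
  have pos: "0 < z + e" if "z \<in> {0..1}" for z
    using that e by auto
  show "z * (1 - z) / (z + e)\<^sup>2 - w * (1 - w) / (w + e)\<^sup>2 = (z - w) * ?d z w"
    if "z \<in> {0..1}" "w \<in> {0..1}" for z w
    using pos[OF that(1)] pos[OF that(2)] by (simp add: divide_simps) algebra
  show "((\<lambda>z. z * (1 - z) / (z + e)\<^sup>2) has_real_derivative ?d z z) (at z)"
    if "z \<in> {0..1}" for z
    using pos[OF that] by (auto intro!: derivative_eq_intros simp: divide_simps) algebra
  show "continuous_on {0..1} (\<lambda>z. ?d z z)"
    by (intro continuous_intros) (use pos in force)+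
  have K: "3 / e\<^sup>2 \<le> 7 / e\<^sup>2 + 8 / e ^ 4"
    using e by (intro add_increasing2) (auto intro: divide_right_mono)
  have sq: "e\<^sup>2 \<le> (z + e)\<^sup>2" if "z \<in> {0..1}" for z
    using that e by (intro power_mono) auto
  show "\<bar>(1 - z) / (z + e)\<^sup>2\<bar> \<le> 7 / e\<^sup>2 + 8 / e ^ 4" if "z \<in> {0..1}" for z
  proof -
    have "\<bar>(1 - z) / (z + e)\<^sup>2\<bar> \<le> 3 / e\<^sup>2"
      using that e sq[OF that] by (simp add: abs_divide) (intro frac_le, auto)
    with K show ?thesis by linarith
  qed
  show "\<bar>z / (z + e)\<^sup>2\<bar> \<le> 7 / e\<^sup>2 + 8 / e ^ 4" if "z \<in> {0..1}" for z
  proof -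
    have "\<bar>z / (z + e)\<^sup>2\<bar> \<le> 3 / e\<^sup>2"
      using that e sq[OF that] by (simp add: abs_divide) (intro frac_le, auto)
    with K show ?thesis by linarith
  qed
  show "\<bar>?d z w\<bar> \<le> 7 / e\<^sup>2 + 8 / e ^ 4" if zw: "z \<in> {0..1}" "w \<in> {0..1}" for z w
  proof -
    have "e * (1 + e) * ((z + e) + (w + e)) / ((z + e)\<^sup>2 * (w + e)\<^sup>2) \<le> 1 * 2 * 4 / (e\<^sup>2 * e\<^sup>2)"
      using zw e sq by (intro frac_le mult_mono mult_pos_pos) auto
    moreover have "0 \<le> e * (1 + e) * ((z + e) + (w + e)) / ((z + e)\<^sup>2 * (w + e)\<^sup>2)"
      using zw e by simp
    moreover have "(1 + 2 * e) / ((z + e) * (w + e)) \<le> 7 / (e * e)"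
      using zw e by (intro frac_le mult_mono mult_pos_pos) auto
    moreover have "0 \<le> (1 + 2 * e) / ((z + e) * (w + e))" using zw e by simp
    moreover have "1 * 2 * 4 / (e\<^sup>2 * e\<^sup>2) = 8 / e ^ 4" "7 / (e * e) = 7 / e\<^sup>2"
      by (simp_all add: power2_eq_square power4_eq_xxxx mult.assoc)
    ultimately show ?thesis by linarith
  qed
qed (use e in \<open>auto simp: power2_eq_square\<close>)

lemma inverse_Suc_tendsto: "(\<lambda>k. 1 / (real k + 1)) \<longlonglongrightarrow> 0"
  using LIMSEQ_inverse_real_of_nat by (simp add: inverse_eq_divide add.commute)

text \<open>Here \<open>e\<close> tends to 0 in the shifted field. The limit \<open>1 - z\<close>
  does not vanish at the origin, which is paid for by the integrability of the weight times
  \<open>1 / x i\<close>.\<close>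

lemma integral_divergence_unit_field:
  assumes int: "integrable (jacobi_measure n) (selberg_weight n a b c)"
    and int': "\<And>i. i < n \<Longrightarrow> integrable (jacobi_measure n) (\<lambda>x. selberg_weight n a b c x * (1 / x i))"
  shows "(\<integral>x. selberg_weight n a b c x *
            weight_divergence n a b c (\<lambda>z w. - 1) (\<lambda>z. (1 - z) / z) (\<lambda>z. 1) x \<partial>jacobi_measure n) = 0"
proof -
  define e where "e k = 1 / (real k + 1)" for k :: nat
  have e: "0 < e k" "e k \<le> 1" for k by (auto simp: e_def)
  have e0: "e \<longlonglongrightarrow> 0" unfolding e_def by (rule inverse_Suc_tendsto)
  show ?thesis
  proof (rule integral_weight_divergence_limit[OF integral_divergence_shifted_unit_field[OF int e],
        where p = "\<lambda>z. 1 / z" and q = "\<lambda>z w. 1 + 2 * (1 / z)"])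
    fix z :: real assume z: "z \<in> {0<..1}"
    show "(\<lambda>k. (1 - z) / (z + e k)) \<longlonglongrightarrow> (1 - z) / z"
      using z by (auto intro!: tendsto_eq_intros e0)
    show "(\<lambda>k. z / (z + e k)) \<longlonglongrightarrow> 1"
      using z by (auto intro!: tendsto_eq_intros e0)
    show "\<bar>(1 - z) / (z + e k)\<bar> \<le> 1 / z" for k
      using z e[of k] by (simp add: abs_divide) (intro frac_le, auto)
    show "\<bar>z / (z + e k)\<bar> \<le> 1 / z" for k
      using z e[of k] by (simp add: abs_divide) (intro frac_le, auto)
    fix w :: real assume w: "w \<in> {0<..1}"
    show "(\<lambda>k. e k * (1 + e k) / ((z + e k) * (w + e k)) - 1) \<longlonglongrightarrow> - 1"
      using z w by (auto intro!: tendsto_eq_intros e0)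
    show "\<bar>e k * (1 + e k) / ((z + e k) * (w + e k)) - 1\<bar> \<le> 1 + 2 * (1 / z)" for k
    proof -
      \<comment> \<open>The numerator \<open>e k\<close> is spent on the factor in \<open>w\<close>,
        where the quotient is at most 1. The majorant then involves only one inverse coordinate, so
        that applying the lemma to the weight divided by \<open>x 0\<close> needs second order
        inverse moments, not third order ones.\<close>
      have "e k * (1 + e k) / ((z + e k) * (w + e k)) = (1 + e k) / (z + e k) * (e k / (w + e k))"
        by simp
      also have "\<dots> \<le> 2 / z * 1"
        using z w e[of k] by (intro mult_mono frac_le) auto
      finally have "e k * (1 + e k) / ((z + e k) * (w + e k)) \<le> 2 * (1 / z)" by simp
      moreover have "0 \<le> e k * (1 + e k) / ((z + e k) * (w + e k))" using z w e[of k] by simp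
      ultimately show ?thesis by linarith
    qed
  next
    fix i assume i: "i < n"
    then show "integrable (jacobi_measure n) (\<lambda>x. selberg_weight n a b c x * (1 / x i))" by (rule int')
    have "integrable (jacobi_measure n) (\<lambda>x. selberg_weight n a b c x + 2 * (selberg_weight n a b c x * (1 / x i)))"
      by (intro Bochner_Integration.integrable_add integrable_mult_right int int'[OF i])
    then show "integrable (jacobi_measure n) (\<lambda>x. selberg_weight n a b c x * (1 + 2 * (1 / x i)))"
      by (simp add: algebra_simps)
  qed (rule measurable_weight_divergence; measurable)+
qed

text \<open>The same passage to the limit for the field \<open>1 / z - 1\<close>, whose divided
  difference is \<open>- 1 / (z * w)\<close>; this is where the mixed inverse products
  enter.\<close>

lemma integral_divergence_inverse_field:
  assumes int: "integrable (jacobi_measure n) (selberg_weight n a b c)"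
    and int': "\<And>i j. i < n \<Longrightarrow> j < n \<Longrightarrow>
       integrable (jacobi_measure n) (\<lambda>x. selberg_weight n a b c x * (1 / (x i * x j)))"
  shows "(\<integral>x. selberg_weight n a b c x *
            weight_divergence n a b c (\<lambda>z w. - 1 / (z * w)) (\<lambda>z. (1 - z) / z\<^sup>2) (\<lambda>z. 1 / z) x \<partial>jacobi_measure n) = 0"
proof -
  define e where "e k = 1 / (real k + 1)" for k :: nat
  have e: "0 < e k" "e k \<le> 1" for k by (auto simp: e_def)
  have e0: "e \<longlonglongrightarrow> 0" unfolding e_def by (rule inverse_Suc_tendsto)
  show ?thesis
  proof (rule integral_weight_divergence_limit[OF integral_divergence_shifted_inverse_field[OF int e],
        where p = "\<lambda>z. 1 / z\<^sup>2" and q = "\<lambda>z w. 7 * (1 / (z * w))"])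
    fix z :: real assume z: "z \<in> {0<..1}"
    have sq: "z\<^sup>2 \<le> (z + e k)\<^sup>2" "0 < z\<^sup>2" for k
      using z e[of k] by (auto intro: power_mono)
    show "(\<lambda>k. (1 - z) / (z + e k)\<^sup>2) \<longlonglongrightarrow> (1 - z) / z\<^sup>2"
      using z by (auto intro!: tendsto_eq_intros e0)
    show "(\<lambda>k. z / (z + e k)\<^sup>2) \<longlonglongrightarrow> 1 / z"
      using z by (auto intro!: tendsto_eq_intros e0 simp: power2_eq_square)
    show "\<bar>(1 - z) / (z + e k)\<^sup>2\<bar> \<le> 1 / z\<^sup>2" for k
      using z e[of k] sq by (simp add: abs_divide) (intro frac_le, auto)
    show "\<bar>z / (z + e k)\<^sup>2\<bar> \<le> 1 / z\<^sup>2" for k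
      using z e[of k] sq by (simp add: abs_divide) (intro frac_le, auto)
    fix w :: real assume w: "w \<in> {0<..1}"
    show "(\<lambda>k. e k * (1 + e k) * ((z + e k) + (w + e k)) / ((z + e k)\<^sup>2 * (w + e k)\<^sup>2)
            - (1 + 2 * e k) / ((z + e k) * (w + e k))) \<longlonglongrightarrow> - 1 / (z * w)"
      using z w by (auto intro!: tendsto_eq_intros e0)
    show "\<bar>e k * (1 + e k) * ((z + e k) + (w + e k)) / ((z + e k)\<^sup>2 * (w + e k)\<^sup>2)
            - (1 + 2 * e k) / ((z + e k) * (w + e k))\<bar> \<le> 7 * (1 / (z * w))" for k
    proof -
      have p: "0 < z + e k" "0 < w + e k" using z w e[of k] by auto
      have le: "1 / ((z + e k) * (w + e k)) \<le> 1 / (z * w)"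
        using z w e[of k] by (intro frac_le mult_mono mult_pos_pos) auto
      \<comment> \<open>One factor \<open>1 / ((z + e k) * (w + e k))\<close> is split off; the two
        remaining quotients are at most 1 each. This gives the constant 4, and the second term of
        the divided difference adds 3 to make 7.\<close>
      have "e k * (1 + e k) * ((z + e k) + (w + e k)) / ((z + e k)\<^sup>2 * (w + e k)\<^sup>2)
         = (1 + e k) * (e k / (w + e k) + e k / (z + e k)) * (1 / ((z + e k) * (w + e k)))"
        using p by (simp add: divide_simps) algebra
      also have "\<dots> \<le> 2 * (1 + 1) * (1 / (z * w))"
        using z w e[of k] le by (intro mult_mono add_mono) auto
      finally have "e k * (1 + e k) * ((z + e k) + (w + e k)) / ((z + e k)\<^sup>2 * (w + e k)\<^sup>2) \<le> 4 * (1 / (z * w))"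
        by simp
      moreover have "0 \<le> e k * (1 + e k) * ((z + e k) + (w + e k)) / ((z + e k)\<^sup>2 * (w + e k)\<^sup>2)"
        using z w e[of k] by simp
      moreover have "(1 + 2 * e k) * (1 / ((z + e k) * (w + e k))) \<le> 3 * (1 / (z * w))"
        using z w e[of k] le by (intro mult_mono) auto
      moreover have "0 \<le> (1 + 2 * e k) * (1 / ((z + e k) * (w + e k)))" using z w e[of k] by simp
      moreover have "0 \<le> 1 / (z * w)" using z w by simp
      ultimately show ?thesis by simp
    qed
  next
    fix i assume i: "i < n"
    show "integrable (jacobi_measure n) (\<lambda>x. selberg_weight n a b c x * (1 / (x i)\<^sup>2))"
      using int'[OF i i] by (simp add: power2_eq_square)
    fix j assume j: "j < n"
    show "integrable (jacobi_measure n) (\<lambda>x. selberg_weight n a b c x * (7 * (1 / (x i * x j))))"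
      using integrable_mult_right[OF int'[OF i j], of 7] by (simp only: mult.left_commute)
  qed (rule measurable_weight_divergence; measurable)+
qed

subsection \<open>Symmetry and necessary conditions for convergence\<close>

lemma distr_jacobi_measure_reindex:
  assumes "bij_betw \<pi> {..<n} {..<n}"
  shows "distr (jacobi_measure n) (jacobi_measure n) (\<lambda>x. \<lambda>j\<in>{..<n}. x (\<pi> j)) = jacobi_measure n"
  using distr_PiM_reindex[of "{..<n}" "\<lambda>_. unit_lborel" \<pi> "{..<n}"] assms prob_space_unit_lborel
  unfolding jacobi_measure_def by (auto simp: bij_betw_def)

lemma selberg_weight_reindex:
  assumes bij: "bij_betw \<pi> {..<n} {..<n}"
  shows "selberg_weight n (\<lambda>_. \<alpha>) b c (\<lambda>j\<in>{..<n}. x (\<pi> j)) = selberg_weight n (\<lambda>_. \<alpha>) b c x"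
proof -
  have "(\<Prod>i<n. \<Prod>j\<in>{..<n} - {i}. \<bar>x (\<pi> i) - x (\<pi> j)\<bar> powr c)
      = (\<Prod>i<n. \<Prod>j\<in>{..<n} - {\<pi> i}. \<bar>x (\<pi> i) - x j\<bar> powr c)"
  proof (rule prod.cong[OF refl])
    fix i assume "i \<in> {..<n}"
    with bij have "bij_betw \<pi> ({..<n} - {i}) ({..<n} - {\<pi> i})"
      using inj_on_image_set_diff[of \<pi> "{..<n}" "{..<n}" "{i}"]
      by (auto simp: bij_betw_def intro: inj_on_diff)
    then show "(\<Prod>j\<in>{..<n} - {i}. \<bar>x (\<pi> i) - x (\<pi> j)\<bar> powr c)
        = (\<Prod>j\<in>{..<n} - {\<pi> i}. \<bar>x (\<pi> i) - x j\<bar> powr c)"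
      by (rule prod.reindex_bij_betw)
  qed
  also have "\<dots> = (\<Prod>i<n. \<Prod>j\<in>{..<n} - {i}. \<bar>x i - x j\<bar> powr c)"
    by (rule prod.reindex_bij_betw[OF bij])
  finally have "(\<Prod>i<n. \<Prod>j\<in>{..<n} - {i}. \<bar>x (\<pi> i) - x (\<pi> j)\<bar> powr c)
      = (\<Prod>i<n. \<Prod>j\<in>{..<n} - {i}. \<bar>x i - x j\<bar> powr c)" .
  moreover have "(\<Prod>i<n. x (\<pi> i) powr (\<alpha> - 1)) = (\<Prod>i<n. x i powr (\<alpha> - 1))"
    by (rule prod.reindex_bij_betw[OF bij])
  moreover have "(\<Prod>i<n. (1 - x (\<pi> i)) powr (b - 1)) = (\<Prod>i<n. (1 - x i) powr (b - 1))"
    by (rule prod.reindex_bij_betw[OF bij])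
  ultimately show ?thesis
    by (simp add: selberg_weight_def)
qed

text \<open>A permutation of the coordinates preserves the product measure and, as the exponent at
  the origin is constant here, the weight as well. Only the test function changes.\<close>

lemma selberg_symmetry:
  fixes F :: "(nat \<Rightarrow> real) \<Rightarrow> real"
  assumes bij: "bij_betw \<pi> {..<n} {..<n}"
    and F: "F \<in> borel_measurable (jacobi_measure n)"
    and FG: "\<And>x. F (\<lambda>j\<in>{..<n}. x (\<pi> j)) = G x"
  shows "integrable (jacobi_measure n) (\<lambda>x. selberg_weight n (\<lambda>_. \<alpha>) b c x * G x)
      \<longleftrightarrow> integrable (jacobi_measure n) (\<lambda>x. selberg_weight n (\<lambda>_. \<alpha>) b c x * F x)"
    and "(\<integral>x. selberg_weight n (\<lambda>_. \<alpha>) b c x * G x \<partial>jacobi_measure n)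
       = (\<integral>x. selberg_weight n (\<lambda>_. \<alpha>) b c x * F x \<partial>jacobi_measure n)"
proof -
  let ?M = "jacobi_measure n"
  let ?T = "\<lambda>x. \<lambda>j\<in>{..<n}. x (\<pi> j)"
  let ?W = "selberg_weight n (\<lambda>_. \<alpha>) b c"
  have T: "?T \<in> measurable ?M ?M"
    using bij unfolding jacobi_measure_def
    by (intro measurable_restrict measurable_component_singleton) (auto simp: bij_betw_def)
  have m: "(\<lambda>x. ?W x * F x) \<in> borel_measurable ?M"
    using F by measurable
  have eq: "?W (?T x) * F (?T x) = ?W x * G x" for x
    by (simp only: selberg_weight_reindex[OF bij] FG)
  show "integrable ?M (\<lambda>x. ?W x * G x) \<longleftrightarrow> integrable ?M (\<lambda>x. ?W x * F x)"
    using integrable_distr_eq[OF T m] unfolding distr_jacobi_measure_reindex[OF bij] eq by simp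
  show "(\<integral>x. ?W x * G x \<partial>?M) = (\<integral>x. ?W x * F x \<partial>?M)"
    using integral_distr[OF T m] unfolding distr_jacobi_measure_reindex[OF bij] eq by simp
qed

section \<open>Generic points and divergence along coordinate lines\<close>

lemma AE_unit_product_neq:
  fixes I :: "nat set"
  assumes I: "finite I" and ij: "i \<in> I" "j \<in> I" "i \<noteq> j"
  shows "AE x in PiM I (\<lambda>_. unit_lborel). x i \<noteq> (x j :: real)"
proof -
  let ?P = "\<lambda>I. PiM I (\<lambda>_::nat. unit_lborel)"
  define J where "J = I - {i}"
  have J: "finite J" "i \<notin> J" "I = insert i J" "j \<in> J" using I ij by (auto simp: J_def)
  have comp: "(\<lambda>x. x k) \<in> borel_measurable (?P I)" if "k \<in> I" for k
    using measurable_compose[OF measurable_component_singleton[OF that] measurable_unit_lborelI[OF continuous_on_id]]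
    by simp
  have m: "(\<lambda>x. indicator {0} (x i - x j) :: ennreal) \<in> borel_measurable (?P (insert i J))"
    unfolding J(3)[symmetric] using comp ij by measurable
  \<comment> \<open>Fubini with coordinate \<open>i\<close> as the inner variable: for fixed
    remaining coordinates the indicator lives on the single point \<open>x j\<close>, a null
    set.\<close>
  have "(\<integral>\<^sup>+x. indicator {0} (x i - x j) \<partial>?P I)
     = (\<integral>\<^sup>+x. \<integral>\<^sup>+y. indicator {0} ((x(i := y)) i - (x(i := y)) j) \<partial>unit_lborel \<partial>?P J)"
    using unit_product.product_nn_integral_insert[OF J(1,2) m] by (simp only: J(3)[symmetric])
  also have "\<dots> = (\<integral>\<^sup>+x. \<integral>\<^sup>+y. indicator {x j} y * indicator {0..1} y \<partial>lborel \<partial>?P J)"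
    using J(2,4) by (intro nn_integral_cong)
      (auto simp: nn_integral_unit_lborel indicator_def intro!: nn_integral_cong)
  also have "\<dots> = (\<integral>\<^sup>+x. 0 \<partial>?P J)"
  proof (intro nn_integral_cong)
    fix x :: "nat \<Rightarrow> real"
    have "AE y in lborel. indicator {x j} y * indicator {0..1} y = (0 :: ennreal)"
      using AE_lborel_singleton[of "x j"] by eventually_elim auto
    from nn_integral_cong_AE[OF this] have "(\<integral>\<^sup>+y. indicator {x j} y * indicator {0..1} y \<partial>lborel) = (\<integral>\<^sup>+y. 0 \<partial>(lborel :: real measure))" .
    then show "(\<integral>\<^sup>+y. indicator {x j} y * indicator {0..1} y \<partial>lborel) = 0"
      by simp
  qed
  finally have "(\<integral>\<^sup>+x. indicator {0} (x i - x j) \<partial>?P I) = 0" by simp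
  then have "AE x in ?P I. indicator {0} (x i - x j) = (0 :: ennreal)"
    using m by (subst (asm) nn_integral_0_iff_AE) (simp_all add: J(3)[symmetric])
  then show ?thesis
    by eventually_elim (auto simp: indicator_def split: if_splits)
qed

lemma AE_unit_product_generic:
  assumes I: "finite I"
  shows "AE x in PiM I (\<lambda>_. unit_lborel).
     (\<forall>i\<in>I. 0 < x i \<and> x i < (1::real)) \<and> (\<forall>i\<in>I. \<forall>j\<in>I. i \<noteq> j \<longrightarrow> x i \<noteq> x (j::nat))"
proof -
  have "AE y in lborel. y \<in> {0..1::real} \<longrightarrow> 0 < y \<and> y < 1"
    using AE_lborel_singleton[of "0::real"] AE_lborel_singleton[of "1::real"]
    by eventually_elim auto
  then have "AE y in unit_lborel. 0 < y \<and> y < 1"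
    by (subst AE_restrict_space_iff) auto
  then have "AE x in PiM I (\<lambda>_. unit_lborel). 0 < x i \<and> x i < 1" if "i \<in> I" for i
    using that prob_space_unit_lborel by (intro AE_PiM_component) auto
  then show ?thesis
    using I by (auto simp: AE_finite_all intro!: AE_unit_product_neq)
qed

text \<open>The logarithmic divergence of \<open>1 / (y - c)\<close> at \<open>c\<close>, in a form
  that serves both the singularity at the origin and the one on a diagonal.\<close>

lemma nn_integral_inverse_eq_infinity:
  fixes f :: "real \<Rightarrow> real"
  assumes c: "0 \<le> c" and r: "c < r" "r \<le> 1" and m: "0 < m"
    and f: "\<And>y. y \<in> {c<..r} \<Longrightarrow> m / (y - c) \<le> f y"
  shows "(\<integral>\<^sup>+y. ennreal (f y) \<partial>unit_lborel) = \<infinity>"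
proof -
  let ?T = "\<integral>\<^sup>+y. ennreal (f y) \<partial>unit_lborel"
  have "of_nat N * ennreal m \<le> ?T" for N :: nat
  proof -
    \<comment> \<open>This cutoff makes the integral of \<open>m / (y - c)\<close> over
      \<open>{s..r}\<close> exactly \<open>N * m\<close>, so letting \<open>N\<close> grow gives
      infinity.\<close>
    define s where "s = c + (r - c) * exp (- real N)"
    have "(r - c) * exp (- real N) \<le> r - c"
      using r by (intro mult_left_le) auto
    moreover have "0 < (r - c) * exp (- real N)"
      using r by simp
    ultimately have s: "c < s" "s \<le> r"
      unfolding s_def by linarith+
    have "(\<integral>\<^sup>+y. ennreal (m / (y - c)) * indicator {s..r} y \<partial>lborel)
       = ennreal (m * ln (r - c) - m * ln (s - c))"
    proof (rule nn_integral_FTC_Icc[where F = "\<lambda>y. m * ln (y - c)"])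
      show "((\<lambda>y. m * ln (y - c)) has_real_derivative m / (y - c)) (at y)"
        if "y \<in> {s..r}" for y
        using that s by (auto intro!: derivative_eq_intros simp: field_simps)
    qed (use s m in auto)
    also have "m * ln (r - c) - m * ln (s - c) = real N * m"
    proof -
      have l: "ln (s - c) = ln (r - c) - real N"
        using r by (simp add: s_def ln_mult)
      show ?thesis unfolding l right_diff_distrib by simp
    qed
    finally have "of_nat N * ennreal m = (\<integral>\<^sup>+y. ennreal (m / (y - c)) * indicator {s..r} y \<partial>lborel)"
      using m by (simp add: ennreal_mult ennreal_of_nat_eq_real_of_nat)
    also have "\<dots> \<le> (\<integral>\<^sup>+y. ennreal (f y) * indicator {0..1} y \<partial>lborel)"
      using f s r c by (intro nn_integral_mono) (auto simp: indicator_def intro!: ennreal_leI)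
    finally show ?thesis by (simp add: nn_integral_unit_lborel)
  qed
  then have "top * ennreal m \<le> ?T"
    by (subst ennreal_SUP_of_nat_eq_top[symmetric], subst SUP_mult_right_ennreal) (auto intro: SUP_least)
  then show ?thesis
    using m by (simp add: ennreal_top_mult top_unique)
qed

text \<open>By Fubini almost every section in coordinate 0 has a finite integral, and almost every
  choice of the other coordinates is interior and free of coincidences. The remaining coordinates
  form a probability space, so some point has all these properties.\<close>

lemma exists_generic_section:
  fixes f :: "(nat \<Rightarrow> real) \<Rightarrow> real"
  assumes n: "1 \<le> n" and int: "integrable (jacobi_measure n) f"
  obtains x where "\<And>i. 0 < i \<Longrightarrow> i < n \<Longrightarrow> 0 < x i \<and> x i < 1"
    and "\<And>i j. 0 < i \<Longrightarrow> i < n \<Longrightarrow> 0 < j \<Longrightarrow> j < n \<Longrightarrow> i \<noteq> j \<Longrightarrow> x i \<noteq> x j"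
    and "(\<integral>\<^sup>+y. ennreal (f (x(0 := y))) \<partial>unit_lborel) \<noteq> \<infinity>"
proof -
  let ?P = "PiM {0<..<n} (\<lambda>_. unit_lborel)"
  have ins: "{..<n} = insert 0 {0<..<n}" using n by auto
  have "f \<in> borel_measurable (jacobi_measure n)"
    using int by auto
  then have m: "(\<lambda>x. ennreal (f x)) \<in> borel_measurable (PiM (insert 0 {0<..<n}) (\<lambda>_. unit_lborel))"
    by (simp add: jacobi_measure_def ins)
  have "(\<integral>\<^sup>+x. ennreal (f x) \<partial>jacobi_measure n) \<le> (\<integral>\<^sup>+x. ennreal (norm (f x)) \<partial>jacobi_measure n)"
    by (intro nn_integral_mono ennreal_leI) simp
  also have "\<dots> < \<infinity>"
    using int by (simp add: integrable_iff_bounded)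
  finally have "(\<integral>\<^sup>+x. ennreal (f x) \<partial>jacobi_measure n) < \<infinity>" .
  moreover have "(\<integral>\<^sup>+x. ennreal (f x) \<partial>jacobi_measure n)
     = (\<integral>\<^sup>+x. \<integral>\<^sup>+y. ennreal (f (x(0 := y))) \<partial>unit_lborel \<partial>?P)"
    unfolding jacobi_measure_def ins by (rule unit_product.product_nn_integral_insert[OF _ _ m]) auto
  ultimately have fin: "(\<integral>\<^sup>+x. \<integral>\<^sup>+y. ennreal (f (x(0 := y))) \<partial>unit_lborel \<partial>?P) \<noteq> \<infinity>"
    by simp
  have "(\<lambda>x. \<integral>\<^sup>+y. ennreal (f (x(0 := y))) \<partial>unit_lborel) \<in> borel_measurable ?P"
  proof (rule unit_product.M.borel_measurable_nn_integral)
    have "(\<lambda>p. (fst p)(0 := snd p)) \<in> measurable (?P \<Otimes>\<^sub>M unit_lborel) (PiM (insert 0 {0<..<n}) (\<lambda>_. unit_lborel))"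
      using measurable_add_dim[of 0 "{0<..<n}" "\<lambda>_. unit_lborel"] by (simp add: case_prod_beta)
    from measurable_compose[OF this m]
    show "(\<lambda>(x, y). ennreal (f (x(0 := y)))) \<in> borel_measurable (?P \<Otimes>\<^sub>M unit_lborel)"
      by (simp add: case_prod_beta)
  qed
  from nn_integral_PInf_AE[OF this fin] AE_unit_product_generic[of "{0<..<n}"]
  have "AE x in ?P. (\<integral>\<^sup>+y. ennreal (f (x(0 := y))) \<partial>unit_lborel) \<noteq> \<infinity> \<and>
     (\<forall>i\<in>{0<..<n}. 0 < x i \<and> x i < 1) \<and> (\<forall>i\<in>{0<..<n}. \<forall>j\<in>{0<..<n}. i \<noteq> j \<longrightarrow> x i \<noteq> x j)"
    by auto
  moreover have "prob_space ?P"
    by (rule prob_space_PiM) (rule prob_space_unit_lborel)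
  ultimately obtain x where "(\<integral>\<^sup>+y. ennreal (f (x(0 := y))) \<partial>unit_lborel) \<noteq> \<infinity> \<and>
     (\<forall>i\<in>{0<..<n}. 0 < x i \<and> x i < 1) \<and> (\<forall>i\<in>{0<..<n}. \<forall>j\<in>{0<..<n}. i \<noteq> j \<longrightarrow> x i \<noteq> x j)"
    using prob_space.ae_filter_bot[of ?P] eventually_happens' by blast
  then show thesis
    by (intro that) auto
qed

text \<open>\<open>P\<close>, \<open>A\<close> and \<open>B\<close> select factors of the weight
  that are positive at \<open>z\<close>. Their product is positive and depends continuously on
  coordinate 0 near \<open>z 0\<close>, so half of its value at \<open>z\<close> is a lower bound on
  a short interval to the right.\<close>

lemma partial_weight_lower_bound:
  fixes z :: "nat \<Rightarrow> real" and P :: "(nat \<times> nat) set"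
  assumes fin: "finite P" "finite A" "finite B"
    and P: "\<And>i j. (i, j) \<in> P \<Longrightarrow> z i \<noteq> z j"
    and A: "\<And>i. i \<in> A \<Longrightarrow> 0 < z i"
    and B: "\<And>i. i \<in> B \<Longrightarrow> z i < 1"
  obtains m r where "0 < m" "z 0 < r"
    "\<And>y. y \<in> {z 0..r} \<Longrightarrow> m \<le> (\<Prod>(i, j)\<in>P. \<bar>(z(0 := y)) i - (z(0 := y)) j\<bar> powr c) *
       (\<Prod>i\<in>A. (z(0 := y)) i powr a) * (\<Prod>i\<in>B. (1 - (z(0 := y)) i) powr b)"
proof -
  define g where "g x = (\<Prod>(i, j)\<in>P. \<bar>x i - x j\<bar> powr c) *
       (\<Prod>i\<in>A. x i powr a) * (\<Prod>i\<in>B. (1 - x i) powr b)" for x :: "nat \<Rightarrow> real"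
  have coord: "((\<lambda>y. (z(0 := y)) i) \<longlongrightarrow> z i) (nhds (z 0))" for i
    by (cases "i = 0") (auto simp: filterlim_ident)
  have "((\<lambda>y. g (z(0 := y))) \<longlongrightarrow> g z) (nhds (z 0))"
    unfolding g_def case_prod_beta
    by (intro tendsto_mult tendsto_prod tendsto_powr tendsto_rabs tendsto_diff tendsto_const coord)
      (use P A B in \<open>force+\<close>)
  moreover have g0: "0 < g z"
    unfolding g_def using P A B by (intro mult_pos_pos prod_pos) fastforce+
  ultimately have "eventually (\<lambda>y. g z / 2 < g (z(0 := y))) (nhds (z 0))"
    by (intro order_tendstoD(1)) auto
  then obtain e where e: "0 < e" "\<And>y. dist y (z 0) < e \<Longrightarrow> g z / 2 < g (z(0 := y))"
    unfolding eventually_nhds_metric by blast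
  show thesis
  proof (rule that[of "g z / 2" "z 0 + e / 2"])
    fix y assume "y \<in> {z 0..z 0 + e / 2}"
    then have "dist y (z 0) < e" using e(1) by (auto simp: dist_real_def)
    from e(2)[OF this] show "g z / 2 \<le> (\<Prod>(i, j)\<in>P. \<bar>(z(0 := y)) i - (z(0 := y)) j\<bar> powr c) *
       (\<Prod>i\<in>A. (z(0 := y)) i powr a) * (\<Prod>i\<in>B. (1 - (z(0 := y)) i) powr b)"
      by (simp only: g_def)
  qed (use e g0 in auto)
qed

lemma selberg_weight_pairs:
  "selberg_weight n a b c x = (\<Prod>(i, j)\<in>Sigma {..<n} (\<lambda>i. {..<n} - {i}). \<bar>x i - x j\<bar> powr c) *
     (\<Prod>i<n. x i powr (a i - 1)) * (\<Prod>i<n. (1 - x i) powr (b - 1))"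
  unfolding selberg_weight_def by (subst prod.Sigma) auto

text \<open>With the other coordinates fixed, the integrand near \<open>x 0 = 0\<close> is at least
  a constant times \<open>y powr (\<alpha> - 3)\<close>. For \<open>\<alpha> \<le> 2\<close> this
  dominates \<open>1 / y\<close>, contradicting the finiteness of the section.\<close>

lemma origin_exponent_bound:
  assumes n: "1 \<le> n"
    and int: "integrable (jacobi_measure n) (\<lambda>x. selberg_weight n (\<lambda>_. \<alpha>) b c x * (1 / (x 0)\<^sup>2))"
  shows "2 < \<alpha>"
proof (rule ccontr)
  assume \<alpha>: "\<not> 2 < \<alpha>"
  from exists_generic_section[OF n int] obtain x where
    x: "\<And>i. 0 < i \<Longrightarrow> i < n \<Longrightarrow> 0 < x i \<and> x i < 1"
    and neq: "\<And>i j. 0 < i \<Longrightarrow> i < n \<Longrightarrow> 0 < j \<Longrightarrow> j < n \<Longrightarrow> i \<noteq> j \<Longrightarrow> x i \<noteq> x j"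
    and fin: "(\<integral>\<^sup>+y. ennreal (selberg_weight n (\<lambda>_. \<alpha>) b c (x(0 := y)) * (1 / ((x(0 := y)) 0)\<^sup>2)) \<partial>unit_lborel) \<noteq> \<infinity>"
    by blast
  \<comment> \<open>Coordinate 0 is moved to the singular point. Of all factors only the power of
    coordinate 0 itself degenerates there, and \<open>?g\<close> omits exactly that one.\<close>
  let ?z = "x(0 := 0)"
  let ?g = "\<lambda>x. (\<Prod>(i, j)\<in>Sigma {..<n} (\<lambda>i. {..<n} - {i}). \<bar>x i - x j\<bar> powr c) *
       (\<Prod>i\<in>{..<n} - {0}. x i powr (\<alpha> - 1)) * (\<Prod>i<n. (1 - x i) powr (b - 1))"
  obtain m r where m: "0 < m" and r: "?z 0 < r" and g: "\<And>y. y \<in> {?z 0..r} \<Longrightarrow> m \<le> ?g (?z(0 := y))"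
  proof (rule partial_weight_lower_bound[of "Sigma {..<n} (\<lambda>i. {..<n} - {i})" "{..<n} - {0}" "{..<n}" ?z c "\<alpha> - 1" "b - 1"])
    fix i j assume "(i, j) \<in> Sigma {..<n} (\<lambda>i. {..<n} - {i})"
    then show "?z i \<noteq> ?z j"
      using x[of i] x[of j] neq[of i j] by auto
  next
    fix i assume "i \<in> {..<n}"
    then show "?z i < 1" using x[of i] by auto
  qed (use x in auto)
  have "(\<integral>\<^sup>+y. ennreal (selberg_weight n (\<lambda>_. \<alpha>) b c (x(0 := y)) * (1 / ((x(0 := y)) 0)\<^sup>2)) \<partial>unit_lborel) = \<infinity>"
  proof (rule nn_integral_inverse_eq_infinity[where c = 0 and r = "min r 1" and m = m])
    fix y assume y: "y \<in> {0<..min r 1}"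
    have W: "selberg_weight n (\<lambda>_. \<alpha>) b c (x(0 := y)) = y powr (\<alpha> - 1) * ?g (?z(0 := y))"
      using n prod.remove[of "{..<n}" 0 "\<lambda>i. (x(0 := y)) i powr (\<alpha> - 1)"]
      by (simp add: selberg_weight_pairs)
    have "1 / y = y powr (-1)" using y by (simp add: powr_minus_divide)
    also have "\<dots> \<le> y powr (\<alpha> - 3)" using \<alpha> y by (intro powr_mono') auto
    also have "\<dots> = y powr (\<alpha> - 1) * (1 / y\<^sup>2)"
      using y powr_diff[of y "\<alpha> - 1" 2] by (simp add: powr_numeral)
    finally have "1 / y * m \<le> (y powr (\<alpha> - 1) * (1 / y\<^sup>2)) * ?g (?z(0 := y))"
      using g[of y] y m by (intro mult_mono) auto
    then show "m / (y - 0) \<le> selberg_weight n (\<lambda>_. \<alpha>) b c (x(0 := y)) * (1 / ((x(0 := y)) 0)\<^sup>2)"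
      unfolding W by (simp add: mult_ac)
  qed (use r m in auto)
  with fin show False by simp
qed

text \<open>Coordinate 0 approaches coordinate 1 from the right. The singular factor occurs for both
  ordered pairs, so the section behaves like \<open>(y - x 1) powr (c + c)\<close>, which dominates
  \<open>1 / (y - x 1)\<close> once \<open>c + c \<le> -1\<close>.\<close>

lemma diagonal_exponent_bound:
  assumes n: "2 \<le> n" and int: "integrable (jacobi_measure n) (selberg_weight n (\<lambda>_. \<alpha>) b c)"
  shows "- 1 / 2 < c"
proof (rule ccontr)
  assume c: "\<not> - 1 / 2 < c"
  have "1 \<le> n" using n by simp
  from exists_generic_section[OF this int] obtain x where
    x: "\<And>i. 0 < i \<Longrightarrow> i < n \<Longrightarrow> 0 < x i \<and> x i < 1"
    and neq: "\<And>i j. 0 < i \<Longrightarrow> i < n \<Longrightarrow> 0 < j \<Longrightarrow> j < n \<Longrightarrow> i \<noteq> j \<Longrightarrow> x i \<noteq> x j"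
    and fin: "(\<integral>\<^sup>+y. ennreal (selberg_weight n (\<lambda>_. \<alpha>) b c (x(0 := y))) \<partial>unit_lborel) \<noteq> \<infinity>"
    by blast
  let ?z = "x(0 := x 1)"
  let ?S = "Sigma {..<n} (\<lambda>i. {..<n} - {i})"
  let ?g = "\<lambda>x. (\<Prod>(i, j)\<in>?S - {(0, 1)} - {(1, 0)}. \<bar>x i - x j\<bar> powr c) *
       (\<Prod>i<n. x i powr (\<alpha> - 1)) * (\<Prod>i<n. (1 - x i) powr (b - 1))"
  have x1: "0 < x 1" "x 1 < 1" using x[of 1] n by auto
  obtain m r where m: "0 < m" and r: "?z 0 < r" and g: "\<And>y. y \<in> {?z 0..r} \<Longrightarrow> m \<le> ?g (?z(0 := y))"
  proof (rule partial_weight_lower_bound[of "?S - {(0, 1)} - {(1, 0)}" "{..<n}" "{..<n}" ?z c "\<alpha> - 1" "b - 1"])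
    fix i j assume ij: "(i, j) \<in> ?S - {(0, 1)} - {(1, 0)}"
    then consider "i = 0" "1 < j" "j < n" | "j = 0" "1 < i" "i < n" | "0 < i" "0 < j" "i < n" "j < n" "i \<noteq> j"
      by (cases i; cases j; cases "i = 1"; cases "j = 1") auto
    then show "?z i \<noteq> ?z j"
      using neq[of 1 j] neq[of i 1] neq[of i j] by cases auto
  next
    fix i assume "i \<in> {..<n}"
    then show "0 < ?z i" "?z i < 1" using x[of i] x1 by auto
  qed auto
  have "(\<integral>\<^sup>+y. ennreal (selberg_weight n (\<lambda>_. \<alpha>) b c (x(0 := y))) \<partial>unit_lborel) = \<infinity>"
  proof (rule nn_integral_inverse_eq_infinity[where c = "x 1" and r = "min r 1" and m = m])
    fix y assume y: "y \<in> {x 1<..min r 1}"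
    let ?f = "\<lambda>(i, j). \<bar>(x(0 := y)) i - (x(0 := y)) j\<bar> powr c"
    have "prod ?f ?S = ?f (0, 1) * (?f (1, 0) * prod ?f (?S - {(0, 1)} - {(1, 0)}))"
      using n by (subst prod.remove[of ?S "(0, 1)"], simp, simp, subst prod.remove[of _ "(1, 0)"]) auto
    then have W: "selberg_weight n (\<lambda>_. \<alpha>) b c (x(0 := y)) = (\<bar>y - x 1\<bar> powr c * \<bar>x 1 - y\<bar> powr c) * ?g (?z(0 := y))"
      by (simp add: selberg_weight_pairs)
    have "1 / (y - x 1) = (y - x 1) powr (-1)" using y by (simp add: powr_minus_divide)
    also have "\<dots> \<le> (y - x 1) powr (c + c)" using c y x1 by (intro powr_mono') auto
    also have "\<dots> = \<bar>y - x 1\<bar> powr c * \<bar>x 1 - y\<bar> powr c"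
    proof -
      have "\<bar>y - x 1\<bar> = y - x 1" "\<bar>x 1 - y\<bar> = y - x 1" using y by auto
      then show ?thesis by (simp only: powr_add)
    qed
    finally have "1 / (y - x 1) * m \<le> (\<bar>y - x 1\<bar> powr c * \<bar>x 1 - y\<bar> powr c) * ?g (?z(0 := y))"
      using g[of y] y m by (intro mult_mono) auto
    then show "m / (y - x 1) \<le> selberg_weight n (\<lambda>_. \<alpha>) b c (x(0 := y))"
      unfolding W by simp
  qed (use r m x1 in auto)
  with fin show False by simp
qed

text \<open>The weight is positive at generic points, hence almost everywhere, and a nonnegative
  function with zero integral would vanish almost everywhere.\<close>

lemma integral_selberg_weight_pos:
  assumes int: "integrable (jacobi_measure n) (selberg_weight n a b c)"
  shows "0 < (\<integral>x. selberg_weight n a b c x \<partial>jacobi_measure n)"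
proof -
  let ?M = "jacobi_measure n"
  have prob: "prob_space ?M"
    unfolding jacobi_measure_def by (rule prob_space_PiM) (rule prob_space_unit_lborel)
  have pos: "AE x in ?M. 0 < selberg_weight n a b c x"
    unfolding jacobi_measure_def
    using AE_unit_product_generic[OF finite_lessThan[of n]]
  proof (rule AE_mp, intro AE_I2 impI)
    fix x :: "nat \<Rightarrow> real"
    assume x: "(\<forall>i\<in>{..<n}. 0 < x i \<and> x i < 1) \<and> (\<forall>i\<in>{..<n}. \<forall>j\<in>{..<n}. i \<noteq> j \<longrightarrow> x i \<noteq> x j)"
    then have "x i \<noteq> x j" if "i < n" "j < n" "j \<noteq> i" for i j
      using that by auto
    moreover have "0 < x i" "x i \<noteq> 0" "x i \<noteq> 1" if "i < n" for i
      using x that by force+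
    ultimately show "0 < selberg_weight n a b c x"
      unfolding selberg_weight_def by (intro mult_pos_pos prod_pos) simp_all
  qed
  have "(\<integral>x. selberg_weight n a b c x \<partial>?M) \<noteq> 0"
  proof
    assume "(\<integral>x. selberg_weight n a b c x \<partial>?M) = 0"
    then have "AE x in ?M. selberg_weight n a b c x = 0"
      using integral_nonneg_eq_0_iff_AE[OF int] selberg_weight_nonneg by auto
    with pos have "AE x in ?M. False" by eventually_elim auto
    then show False using prob_space.AE_False[OF prob] by simp
  qed
  moreover have "0 \<le> (\<integral>x. selberg_weight n a b c x \<partial>?M)"
    by (intro Bochner_Integration.integral_nonneg selberg_weight_nonneg)
  ultimately show ?thesis by simp
qed

subsection \<open>Moment relations\<close>

text \<open>The exponent \<open>c\<close> is extended to the diagonal and corrected there by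
  \<open>1 - c\<close>, so that the remaining sum over \<open>j\<close> is unrestricted.\<close>

lemma sum_pair_exponents:
  fixes c :: real and i n :: nat
  assumes "i < n"
  shows "(\<Sum>j<n. (if i = j then 1 else c) * k j) = c * (\<Sum>j<n. k j) + (1 - c) * k i"
proof -
  have "(\<Sum>j<n. (if i = j then 1 else c) * k j) = (\<Sum>j<n. c * k j + (if i = j then (1 - c) * k j else 0))"
    by (intro sum.cong) (auto simp: algebra_simps)
  also have "\<dots> = c * (\<Sum>j<n. k j) + (\<Sum>j<n. if i = j then (1 - c) * k j else 0)"
    by (simp only: sum.distrib sum_distrib_left)
  also have "(\<Sum>j<n. if i = j then (1 - c) * k j else 0) = (1 - c) * k i"
    using assms by (subst sum.delta') auto
  finally show ?thesis .
qed

lemma selberg_weight_lower_exponent: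
  assumes n: "1 \<le> n" and x: "0 \<le> x 0"
  shows "selberg_weight n ((\<lambda>_. \<alpha>)(0 := \<alpha> - 1)) b c x = selberg_weight n (\<lambda>_. \<alpha>) b c x * (1 / x 0)"
proof -
  have "(\<Prod>i<n. x i powr (((\<lambda>_. \<alpha>)(0 := \<alpha> - 1)) i - 1))
     = x 0 powr (\<alpha> - 1 - 1) * (\<Prod>i\<in>{..<n} - {0}. x i powr (\<alpha> - 1))"
    using n prod.remove[of "{..<n}" 0 "\<lambda>i. x i powr (((\<lambda>_. \<alpha>)(0 := \<alpha> - 1)) i - 1)"] by simp
  also have "x 0 powr (\<alpha> - 1 - 1) = x 0 powr (\<alpha> - 1) * (1 / x 0)"
    using x powr_diff[of "x 0" "\<alpha> - 1" 1] by simp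
  also have "\<dots> * (\<Prod>i\<in>{..<n} - {0}. x i powr (\<alpha> - 1)) = (\<Prod>i<n. x i powr (\<alpha> - 1)) * (1 / x 0)"
    using n prod.remove[of "{..<n}" 0 "\<lambda>i. x i powr (\<alpha> - 1)"] by simp
  finally show ?thesis
    by (simp add: selberg_weight_def)
qed

text \<open>Identities under the integral that cancel coordinates need checking only where all
  coordinates are positive, since the weight is 0 at the other points of the cube.\<close>

lemma selberg_weight_mult_cong:
  assumes "x \<in> space (jacobi_measure n)"
    and "(\<And>i. i < n \<Longrightarrow> 0 < x i) \<Longrightarrow> f = g"
  shows "selberg_weight n a b c x * f = selberg_weight n a b c x * g"
proof (cases "\<forall>i<n. 0 < x i")
  case False
  then obtain i where "i < n" "x i = 0"
    using space_jacobi_measure[OF assms(1)] by force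
  then show ?thesis by (simp add: selberg_weight_eq_0)
qed (use assms(2) in auto)

lemma integral_lincomb:
  fixes f g h :: "'a \<Rightarrow> real"
  assumes "integrable M f" "integrable M g" "integrable M h"
  shows "(\<integral>x. p * f x - q * g x - r * h x \<partial>M) = p * integral\<^sup>L M f - q * integral\<^sup>L M g - r * integral\<^sup>L M h"
  using assms by simp

context
  fixes n :: nat and \<alpha> \<beta> \<gamma> :: real
  assumes n: "1 \<le> n"
    and int_weight: "integrable (jacobi_measure n) (selberg_weight n (\<lambda>_. \<alpha>) \<beta> \<gamma>)"
    and int_inv_sq: "integrable (jacobi_measure n) (\<lambda>x. selberg_weight n (\<lambda>_. \<alpha>) \<beta> \<gamma> x * (1 / (x 0)\<^sup>2))"
begin

private abbreviation (input) "M \<equiv> jacobi_measure n"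
private abbreviation (input) "W \<equiv> selberg_weight n (\<lambda>_. \<alpha>) \<beta> \<gamma>"

private definition "Z = (\<integral>x. W x \<partial>M)"
private definition "A\<^sub>2 = (\<integral>x. W x * (1 / (x 0)\<^sup>2) \<partial>M)"
private definition "A\<^sub>1 = (\<integral>x. W x * (1 / x 0) \<partial>M)"
text \<open>The sum includes \<open>j = 0\<close>, so the second inverse moment is contained in this
  quantity. The full sum is what the divergences produce, and it is invariant under
  permutations.\<close>

private definition "A\<^sub>1\<^sub>1 = (\<integral>x. W x * (1 / x 0 * (\<Sum>j<n. 1 / x j)) \<partial>M)"

lemma inv_sq_moment:
  assumes "i < n"
  shows "integrable M (\<lambda>x. W x * (1 / (x i)\<^sup>2))" "(\<integral>x. W x * (1 / (x i)\<^sup>2) \<partial>M) = A\<^sub>2"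
  using selberg_symmetry[of "Transposition.transpose 0 i" n "\<lambda>x. 1 / (x 0)\<^sup>2" "\<lambda>x. 1 / (x i)\<^sup>2" \<alpha> \<beta> \<gamma>]
    int_inv_sq n assms by (auto simp: A\<^sub>2_def)

text \<open>The inequality \<open>\<bar>p * q\<bar> \<le> p\<^sup>2 + q\<^sup>2\<close> reduces
  mixed products to the second inverse moments, all integrable by symmetry.\<close>

lemma int_inv_prod:
  assumes ij: "i < n" "j < n"
  shows "integrable M (\<lambda>x. W x * (1 / (x i * x j)))"
proof (rule Bochner_Integration.integrable_bound[where f = "\<lambda>x. W x * (1 / (x i)\<^sup>2) + W x * (1 / (x j)\<^sup>2)"])
  show "integrable M (\<lambda>x. W x * (1 / (x i)\<^sup>2) + W x * (1 / (x j)\<^sup>2))"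
    by (intro Bochner_Integration.integrable_add inv_sq_moment ij)
  show "AE x in M. norm (W x * (1 / (x i * x j))) \<le> norm (W x * (1 / (x i)\<^sup>2) + W x * (1 / (x j)\<^sup>2))"
  proof (rule AE_I2)
    fix x assume "x \<in> space M"
    have "\<bar>p * q\<bar> \<le> p\<^sup>2 + q\<^sup>2" for p q :: real
      using sum_squares_bound[of p q] sum_squares_bound[of p "- q"] by (auto simp: abs_le_iff)
    from this[of "1 / x i" "1 / x j"] have "\<bar>1 / (x i * x j)\<bar> \<le> 1 / (x i)\<^sup>2 + 1 / (x j)\<^sup>2"
      by (simp add: power_divide)
    then have "W x * \<bar>1 / (x i * x j)\<bar> \<le> W x * (1 / (x i)\<^sup>2 + 1 / (x j)\<^sup>2)"
      by (rule mult_left_mono[OF _ selberg_weight_nonneg])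
    then show "norm (W x * (1 / (x i * x j))) \<le> norm (W x * (1 / (x i)\<^sup>2) + W x * (1 / (x j)\<^sup>2))"
      unfolding real_norm_def abs_mult[of "W x"] distrib_left[symmetric] abs_of_nonneg[OF selberg_weight_nonneg]
      by (rule order_trans) (simp add: selberg_weight_nonneg mult_left_mono)
  qed
qed (use ij in measurable)

text \<open>On \<open>{0..1}\<close> one has \<open>1 / x i \<le> 1 / (x i)\<^sup>2\<close>, with
  both sides 0 at the origin; the value does not depend on \<open>i\<close> by symmetry.\<close>

lemma inv_moment:
  assumes i: "i < n"
  shows "integrable M (\<lambda>x. W x * (1 / x i))" "(\<integral>x. W x * (1 / x i) \<partial>M) = A\<^sub>1"
proof -
  show "integrable M (\<lambda>x. W x * (1 / x i))"
  proof (rule Bochner_Integration.integrable_bound[OF inv_sq_moment(1)[OF i]])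
    show "AE x in M. norm (W x * (1 / x i)) \<le> norm (W x * (1 / (x i)\<^sup>2))"
    proof (rule AE_I2)
      fix x assume "x \<in> space M"
      then have "x i \<in> {0..1}" using i by (rule space_jacobi_measure)
      then have "1 / x i \<le> 1 / (x i)\<^sup>2"
        by (cases "x i = 0") (auto intro!: divide_left_mono simp: power2_eq_square mult_left_le_one_le)
      then have "W x * (1 / x i) \<le> W x * (1 / (x i)\<^sup>2)"
        by (rule mult_left_mono[OF _ selberg_weight_nonneg])
      then show "norm (W x * (1 / x i)) \<le> norm (W x * (1 / (x i)\<^sup>2))"
        using \<open>x i \<in> {0..1}\<close> by (simp add: selberg_weight_nonneg)
    qed
  qed (use i in measurable)
  show "(\<integral>x. W x * (1 / x i) \<partial>M) = A\<^sub>1"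
    using selberg_symmetry(2)[of "Transposition.transpose 0 i" n "\<lambda>x. 1 / x 0" "\<lambda>x. 1 / x i" \<alpha> \<beta> \<gamma>] n i
    by (auto simp: A\<^sub>1_def)
qed

lemma inv_prod_moment:
  assumes i: "i < n"
  shows "integrable M (\<lambda>x. W x * (1 / x i * (\<Sum>j<n. 1 / x j)))"
    "(\<integral>x. W x * (1 / x i * (\<Sum>j<n. 1 / x j)) \<partial>M) = A\<^sub>1\<^sub>1"
proof -
  have "integrable M (\<lambda>x. \<Sum>j<n. W x * (1 / (x i * x j)))"
    using i by (intro Bochner_Integration.integrable_sum int_inv_prod) auto
  then show "integrable M (\<lambda>x. W x * (1 / x i * (\<Sum>j<n. 1 / x j)))"
    by (simp add: sum_distrib_left)
  have bij: "bij_betw (Transposition.transpose 0 i) {..<n} {..<n}"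
    using n i by simp
  have F: "(\<lambda>x. 1 / x 0 * (\<Sum>j<n. 1 / x j)) \<in> borel_measurable M"
    using n by (intro borel_measurable_times borel_measurable_sum borel_measurable_divide
        borel_measurable_const measurable_coordinate) auto
  show "(\<integral>x. W x * (1 / x i * (\<Sum>j<n. 1 / x j)) \<partial>M) = A\<^sub>1\<^sub>1"
    unfolding A\<^sub>1\<^sub>1_def
  proof (rule selberg_symmetry(2)[OF bij F])
    fix x :: "nat \<Rightarrow> real"
    have "(\<Sum>j<n. 1 / x (Transposition.transpose 0 i j)) = (\<Sum>j<n. 1 / x j)"
      by (rule sum.reindex_bij_betw[OF bij])
    then show "1 / (\<lambda>j\<in>{..<n}. x (Transposition.transpose 0 i j)) 0 * (\<Sum>j<n. 1 / (\<lambda>j\<in>{..<n}. x (Transposition.transpose 0 i j)) j)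
       = 1 / x i * (\<Sum>j<n. 1 / x j)"
      using n by simp
  qed
qed

lemma int_sum_inv: "integrable M (\<lambda>x. \<Sum>i<n. W x * (1 / x i))"
  and integral_sum_inv: "(\<integral>x. (\<Sum>i<n. W x * (1 / x i)) \<partial>M) = real n * A\<^sub>1"
  using inv_moment by (auto simp: Bochner_Integration.integral_sum simp del: times_divide_eq_right)

text \<open>The field \<open>1 - z\<close> with test function 1. Each row of the double sum
  contributes \<open>- (1 + \<gamma> * (real n - 1))\<close>, and by symmetry the whole relation is
  \<open>n\<close> times the stated one.\<close>

lemma inv_moment_eq: "(\<alpha> - 1) * A\<^sub>1 = (\<alpha> + \<beta> - 1 + \<gamma> * (real n - 1)) * Z"
proof -
  let ?c = "\<alpha> + \<beta> - 1 + \<gamma> * (real n - 1)"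
  let ?E = "weight_divergence n (\<lambda>_. \<alpha>) \<beta> \<gamma> (\<lambda>z w. - 1) (\<lambda>z. (1 - z) / z) (\<lambda>z. 1)"
  have "0 = (\<integral>x. W x * ?E x \<partial>M)"
    by (rule integral_divergence_unit_field[OF int_weight inv_moment(1), symmetric])
  \<comment> \<open>The summand \<open>0 * 0\<close> pads the integrand to the three-term shape of
    \<open>integral_lincomb\<close>.\<close>
  also have "\<dots> = (\<integral>x. (\<alpha> - 1) * (\<Sum>i<n. W x * (1 / x i)) - real n * ?c * W x - 0 * 0 \<partial>M)"
  proof (rule Bochner_Integration.integral_cong[OF refl])
    fix x assume x: "x \<in> space M"
    have "W x * ?E x = W x * ((\<alpha> - 1) * (\<Sum>i<n. 1 / x i) - real n * ?c)"
    proof (rule selberg_weight_mult_cong[OF x])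
      assume pos: "\<And>i. i < n \<Longrightarrow> 0 < x i"
      have "(\<Sum>i<n. (\<alpha> - 1) * ((1 - x i) / x i) - (\<beta> - 1) * 1)
         = (\<Sum>i<n. (\<alpha> - 1) * (1 / x i) - (\<alpha> + \<beta> - 2))"
        using pos by (intro sum.cong refl) (force simp: field_simps)
      also have "\<dots> = (\<alpha> - 1) * (\<Sum>i<n. 1 / x i) - real n * (\<alpha> + \<beta> - 2)"
        by (simp add: sum_subtractf sum_distrib_left)
      moreover have "(\<Sum>i<n. \<Sum>j<n. (if i = j then 1 else \<gamma>) * - 1) = (\<Sum>i<n. \<gamma> * (\<Sum>j<n. - 1) + (1 - \<gamma>) * - 1)"
        by (intro sum.cong refl sum_pair_exponents) simp
      ultimately show "?E x = (\<alpha> - 1) * (\<Sum>i<n. 1 / x i) - real n * ?c"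
        unfolding weight_divergence_def by (simp add: algebra_simps)
    qed
    also have "\<dots> = (\<alpha> - 1) * (\<Sum>i<n. W x * (1 / x i)) - real n * ?c * W x - 0 * 0"
      unfolding sum_distrib_left[symmetric] by algebra
    finally show "W x * ?E x = (\<alpha> - 1) * (\<Sum>i<n. W x * (1 / x i)) - real n * ?c * W x - 0 * 0" .
  qed
  also have "\<dots> = (\<alpha> - 1) * (real n * A\<^sub>1) - real n * ?c * Z - 0 * (\<integral>x. 0 \<partial>M)"
    unfolding Z_def integral_sum_inv[symmetric]
    by (rule integral_lincomb[OF int_sum_inv int_weight]) simp
  also have "\<dots> = real n * ((\<alpha> - 1) * A\<^sub>1 - ?c * Z)"
    by (simp add: algebra_simps)
  finally show ?thesis using n by simp
qed

text \<open>The field \<open>1 - z\<close> with test function \<open>1 / x 0\<close>, which is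
  absorbed into the weight by lowering the exponent of coordinate 0 by one.\<close>

lemma inv_prod_moment_eq:
  "(\<alpha> - 1) * A\<^sub>1\<^sub>1 = A\<^sub>2 + (real n * (\<alpha> + \<beta> - 1 + \<gamma> * (real n - 1)) - 1) * A\<^sub>1"
proof -
  let ?c = "\<alpha> + \<beta> - 1 + \<gamma> * (real n - 1)"
  let ?a = "(\<lambda>_. \<alpha>)(0 := \<alpha> - 1)"
  let ?V = "selberg_weight n ?a \<beta> \<gamma>"
  let ?E = "weight_divergence n ?a \<beta> \<gamma> (\<lambda>z w. - 1) (\<lambda>z. (1 - z) / z) (\<lambda>z. 1)"
  have V: "?V x = W x * (1 / x 0)" if "x \<in> space M" for x
    using space_jacobi_measure[OF that, of 0] n by (intro selberg_weight_lower_exponent) auto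
  have "integrable M ?V"
    using inv_moment(1)[of 0] n by (subst Bochner_Integration.integrable_cong[OF refl V]) auto
  moreover have "integrable M (\<lambda>x. ?V x * (1 / x i))" if "i < n" for i
  proof (subst Bochner_Integration.integrable_cong[OF refl])
    show "?V x * (1 / x i) = W x * (1 / (x 0 * x i))" if "x \<in> space M" for x
      using V[OF that] by simp
    show "integrable M (\<lambda>x. W x * (1 / (x 0 * x i)))"
      using that n by (intro int_inv_prod) auto
  qed
  ultimately have "0 = (\<integral>x. ?V x * ?E x \<partial>M)"
    by (rule integral_divergence_unit_field[symmetric])
  also have "\<dots> = (\<integral>x. (\<alpha> - 1) * (W x * (1 / x 0 * (\<Sum>j<n. 1 / x j)))
       - (real n * ?c - 1) * (W x * (1 / x 0)) - 1 * (W x * (1 / (x 0)\<^sup>2)) \<partial>M)"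
  proof (rule Bochner_Integration.integral_cong[OF refl])
    fix x assume x: "x \<in> space M"
    have "?V x * ?E x = ?V x * ((\<alpha> - 1) * (\<Sum>i<n. 1 / x i) - (real n * ?c - 1) - 1 / x 0)"
    proof (rule selberg_weight_mult_cong[OF x])
      assume pos: "\<And>i. i < n \<Longrightarrow> 0 < x i"
      \<comment> \<open>The lowered exponent removes \<open>1 / x 0 - 1\<close> from the divergence.
        After integration this accounts for the \<open>A\<^sub>2\<close> and the \<open>- 1\<close>
        in the relation.\<close>
      have "(\<Sum>i<n. (?a i - 1) * ((1 - x i) / x i) - (\<beta> - 1) * 1)
         = (\<Sum>i<n. (\<alpha> - 1) * (1 / x i) - (\<alpha> + \<beta> - 2) - (if i = 0 then 1 / x i - 1 else 0))"
      proof (intro sum.cong refl)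
        fix i assume "i \<in> {..<n}"
        then have q: "(1 - x i) / x i = 1 / x i - 1" using pos[of i] by (simp add: field_simps)
        show "(?a i - 1) * ((1 - x i) / x i) - (\<beta> - 1) * 1
           = (\<alpha> - 1) * (1 / x i) - (\<alpha> + \<beta> - 2) - (if i = 0 then 1 / x i - 1 else 0)"
          unfolding q by (cases "i = 0") (simp_all add: algebra_simps diff_divide_distrib)
      qed
      also have "\<dots> = (\<alpha> - 1) * (\<Sum>i<n. 1 / x i) - real n * (\<alpha> + \<beta> - 2) - (1 / x 0 - 1)"
        using n by (simp add: sum_subtractf sum_distrib_left)
      moreover have "(\<Sum>i<n. \<Sum>j<n. (if i = j then 1 else \<gamma>) * - 1) = (\<Sum>i<n. \<gamma> * (\<Sum>j<n. - 1) + (1 - \<gamma>) * - 1)"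
        by (intro sum.cong refl sum_pair_exponents) simp
      ultimately show "?E x = (\<alpha> - 1) * (\<Sum>i<n. 1 / x i) - (real n * ?c - 1) - 1 / x 0"
        unfolding weight_divergence_def by (simp add: algebra_simps)
    qed
    also have "\<dots> = (\<alpha> - 1) * (W x * (1 / x 0 * (\<Sum>j<n. 1 / x j)))
       - (real n * ?c - 1) * (W x * (1 / x 0)) - 1 * (W x * (1 / (x 0)\<^sup>2))"
      unfolding V[OF x] power_one_over[symmetric] by algebra
    finally show "?V x * ?E x = (\<alpha> - 1) * (W x * (1 / x 0 * (\<Sum>j<n. 1 / x j)))
       - (real n * ?c - 1) * (W x * (1 / x 0)) - 1 * (W x * (1 / (x 0)\<^sup>2))" .
  qed
  also have "\<dots> = (\<alpha> - 1) * A\<^sub>1\<^sub>1 - (real n * ?c - 1) * A\<^sub>1 - 1 * A\<^sub>2"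
    unfolding A\<^sub>1\<^sub>1_def A\<^sub>1_def A\<^sub>2_def
    using n by (intro integral_lincomb inv_prod_moment inv_moment inv_sq_moment) auto
  finally show ?thesis by simp
qed

text \<open>The field \<open>1 / z - 1\<close> with test function 1. The diagonal correction
  \<open>- (1 - \<gamma>) / (x i)\<^sup>2\<close> lowers the coefficient \<open>\<alpha> - 1\<close>
  to \<open>\<alpha> - 2 + \<gamma>\<close>.\<close>

lemma inv_sq_moment_eq: "(\<alpha> - 2 + \<gamma>) * A\<^sub>2 = \<gamma> * A\<^sub>1\<^sub>1 + (\<alpha> + \<beta> - 2) * A\<^sub>1"
proof -
  let ?E = "weight_divergence n (\<lambda>_. \<alpha>) \<beta> \<gamma> (\<lambda>z w. - 1 / (z * w)) (\<lambda>z. (1 - z) / z\<^sup>2) (\<lambda>z. 1 / z)"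
  let ?Q = "\<lambda>x. \<Sum>i<n. W x * (1 / (x i)\<^sup>2)"
  let ?T = "\<lambda>x. \<Sum>i<n. W x * (1 / x i * (\<Sum>j<n. 1 / x j))"
  let ?P = "\<lambda>x. \<Sum>i<n. W x * (1 / x i)"
  have Q: "integrable M ?Q" "integral\<^sup>L M ?Q = real n * A\<^sub>2"
    using inv_sq_moment by (auto simp: Bochner_Integration.integral_sum simp del: times_divide_eq_right)
  have T: "integrable M ?T" "integral\<^sup>L M ?T = real n * A\<^sub>1\<^sub>1"
    using inv_prod_moment by (auto simp: Bochner_Integration.integral_sum simp del: times_divide_eq_right)
  have "0 = (\<integral>x. W x * ?E x \<partial>M)"
    by (rule integral_divergence_inverse_field[OF int_weight int_inv_prod, symmetric])
  also have "\<dots> = (\<integral>x. (\<alpha> - 2 + \<gamma>) * ?Q x - \<gamma> * ?T x - (\<alpha> + \<beta> - 2) * ?P x \<partial>M)"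
  proof (rule Bochner_Integration.integral_cong[OF refl])
    fix x assume x: "x \<in> space M"
    have "W x * ?E x = W x * ((\<alpha> - 2 + \<gamma>) * (\<Sum>i<n. 1 / (x i)\<^sup>2)
        - \<gamma> * (\<Sum>i<n. 1 / x i * (\<Sum>j<n. 1 / x j)) - (\<alpha> + \<beta> - 2) * (\<Sum>i<n. 1 / x i))"
    proof (rule selberg_weight_mult_cong[OF x])
      assume pos: "\<And>i. i < n \<Longrightarrow> 0 < x i"
      have "?E x = (\<Sum>i<n. (\<Sum>j<n. (if i = j then 1 else \<gamma>) * (- 1 / (x i * x j))) +
          ((\<alpha> - 1) * ((1 - x i) / (x i)\<^sup>2) - (\<beta> - 1) * (1 / x i)))"
        unfolding weight_divergence_def by (simp add: sum.distrib)
      also have "\<dots> = (\<Sum>i<n. (\<alpha> - 2 + \<gamma>) * (1 / (x i)\<^sup>2) - \<gamma> * (1 / x i * (\<Sum>j<n. 1 / x j))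
          - (\<alpha> + \<beta> - 2) * (1 / x i))"
      proof (intro sum.cong refl)
        fix i assume i: "i \<in> {..<n}"
        have "(\<Sum>j<n. (if i = j then 1 else \<gamma>) * (- 1 / (x i * x j)))
           = \<gamma> * (\<Sum>j<n. - 1 / (x i * x j)) + (1 - \<gamma>) * (- 1 / (x i * x i))"
          using i by (intro sum_pair_exponents) simp
        also have "(\<Sum>j<n. - 1 / (x i * x j)) = - (1 / x i * (\<Sum>j<n. 1 / x j))"
          by (simp add: sum_distrib_left sum_negf[symmetric])
        also have "- 1 / (x i * x i) = - (1 / (x i)\<^sup>2)"
          by (simp add: power2_eq_square)
        moreover have "(1 - x i) / (x i)\<^sup>2 = 1 / (x i)\<^sup>2 - 1 / x i"
          using pos[of i] i by (simp add: power2_eq_square field_simps)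
        ultimately show "(\<Sum>j<n. (if i = j then 1 else \<gamma>) * (- 1 / (x i * x j))) +
            ((\<alpha> - 1) * ((1 - x i) / (x i)\<^sup>2) - (\<beta> - 1) * (1 / x i))
          = (\<alpha> - 2 + \<gamma>) * (1 / (x i)\<^sup>2) - \<gamma> * (1 / x i * (\<Sum>j<n. 1 / x j)) - (\<alpha> + \<beta> - 2) * (1 / x i)"
          by algebra
      qed
      finally show "?E x = (\<alpha> - 2 + \<gamma>) * (\<Sum>i<n. 1 / (x i)\<^sup>2)
        - \<gamma> * (\<Sum>i<n. 1 / x i * (\<Sum>j<n. 1 / x j)) - (\<alpha> + \<beta> - 2) * (\<Sum>i<n. 1 / x i)"
        by (simp only: sum_subtractf sum_distrib_left[symmetric])
    qed
    also have "\<dots> = (\<alpha> - 2 + \<gamma>) * ?Q x - \<gamma> * ?T x - (\<alpha> + \<beta> - 2) * ?P x"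
      unfolding sum_distrib_left[symmetric, of "W x"] by algebra
    finally show "W x * ?E x = (\<alpha> - 2 + \<gamma>) * ?Q x - \<gamma> * ?T x - (\<alpha> + \<beta> - 2) * ?P x" .
  qed
  also have "\<dots> = (\<alpha> - 2 + \<gamma>) * (real n * A\<^sub>2) - \<gamma> * (real n * A\<^sub>1\<^sub>1) - (\<alpha> + \<beta> - 2) * (real n * A\<^sub>1)"
    unfolding Q(2)[symmetric] T(2)[symmetric] integral_sum_inv[symmetric]
    by (rule integral_lincomb[OF Q(1) T(1) int_sum_inv])
  also have "\<dots> = real n * ((\<alpha> - 2 + \<gamma>) * A\<^sub>2 - \<gamma> * A\<^sub>1\<^sub>1 - (\<alpha> + \<beta> - 2) * A\<^sub>1)"
    by algebra
  finally show ?thesis using n by simp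
qed

section \<open>Solving the linear relations for the second inverse moment\<close>

lemma inv_sq_average:
  "(\<integral>x. W x * (1 / (x 0)\<^sup>2) \<partial>M) / (\<integral>x. W x \<partial>M) =
    (\<alpha> + \<beta> + (real n - 1) * \<gamma> - 1) / ((\<alpha> - 1) * (\<alpha> - 2)) *
    (\<alpha> + \<beta> - 2 + \<gamma> * (real n - 1) * (\<alpha> + \<beta> + real n * \<gamma> - 1) / (\<alpha> + \<gamma> - 1))"
proof -
  let ?c = "\<alpha> + \<beta> - 1 + \<gamma> * (real n - 1)"
  let ?R = "?c / ((\<alpha> - 1) * (\<alpha> - 2)) *
    (\<alpha> + \<beta> - 2 + \<gamma> * (real n - 1) * (\<alpha> + \<beta> + real n * \<gamma> - 1) / (\<alpha> + \<gamma> - 1))"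
  have Z: "0 < Z"
    unfolding Z_def by (rule integral_selberg_weight_pos[OF int_weight])
  have \<alpha>: "2 < \<alpha>"
    by (rule origin_exponent_bound[OF n int_inv_sq])
  have A1: "A\<^sub>1 = ?c * Z / (\<alpha> - 1)"
    using inv_moment_eq \<alpha> by (simp add: eq_divide_eq mult.commute)
  \<comment> \<open>The first moment relation supplies the prefactor, leaving only the bracket
    \<open>B\<close> to be identified in each case.\<close>
  have avg: "A\<^sub>2 / Z = ?c / ((\<alpha> - 1) * (\<alpha> - 2)) * B" if "A\<^sub>2 = B * A\<^sub>1 / (\<alpha> - 2)" for B
    using that A1 Z by simp
  have "A\<^sub>2 / Z = ?R"
  proof (cases "n = 1")
    \<comment> \<open>For a single coordinate nothing bounds \<open>\<gamma>\<close>, so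
      \<open>\<alpha> + \<gamma> - 1\<close> may be 0. The fraction over it then still vanishes,
      thanks to the factor \<open>real n - 1\<close>.\<close>
    case True
    have "A\<^sub>1\<^sub>1 = A\<^sub>2"
      unfolding A\<^sub>1\<^sub>1_def A\<^sub>2_def using True by (simp add: power2_eq_square)
    then have "(\<alpha> - 2) * A\<^sub>2 = (\<alpha> + \<beta> - 2) * A\<^sub>1"
      using inv_sq_moment_eq by (simp add: algebra_simps)
    then have A2: "A\<^sub>2 = (\<alpha> + \<beta> - 2) * A\<^sub>1 / (\<alpha> - 2)"
      using \<alpha> by (simp add: eq_divide_eq mult.commute)
    show ?thesis
      using avg[OF A2] True by simp
  next
    case False
    then have "- 1 / 2 < \<gamma>"
      using n by (intro diagonal_exponent_bound[OF _ int_weight]) simp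
    with \<alpha> have pos: "0 < \<alpha> + \<gamma> - 1" by linarith
    \<comment> \<open>Multiplying the third relation by \<open>\<alpha> - 1\<close> and inserting
      the second eliminates \<open>A\<^sub>1\<^sub>1\<close>. The coefficient
      \<open>(\<alpha> - 1) * (\<alpha> - 2 + \<gamma>) - \<gamma>\<close> of
      \<open>A\<^sub>2\<close> factors as displayed.\<close>
    have "(\<alpha> - 2) * (\<alpha> + \<gamma> - 1) * A\<^sub>2
       = ((\<alpha> + \<beta> - 2) * (\<alpha> + \<gamma> - 1) + \<gamma> * (real n - 1) * (\<alpha> + \<beta> + real n * \<gamma> - 1)) * A\<^sub>1"
      using inv_sq_moment_eq inv_prod_moment_eq by algebra
    then have "A\<^sub>2 = ((\<alpha> + \<beta> - 2) * (\<alpha> + \<gamma> - 1) + \<gamma> * (real n - 1) * (\<alpha> + \<beta> + real n * \<gamma> - 1)) * A\<^sub>1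
        / ((\<alpha> - 2) * (\<alpha> + \<gamma> - 1))"
      using \<alpha> pos by (simp add: eq_divide_eq mult.commute)
    also have "\<dots> = (\<alpha> + \<beta> - 2 + \<gamma> * (real n - 1) * (\<alpha> + \<beta> + real n * \<gamma> - 1) / (\<alpha> + \<gamma> - 1)) * A\<^sub>1 / (\<alpha> - 2)"
      using \<alpha> pos by (simp add: add_divide_distrib distrib_right)
    finally show ?thesis
      by (rule avg)
  qed
  moreover have "\<alpha> + \<beta> + (real n - 1) * \<gamma> - 1 = ?c"
    by simp
  ultimately show ?thesis
    by (simp only: A\<^sub>2_def Z_def)
qed

end

theorem theorem2:
  fixes n :: nat and \<alpha> \<beta> \<gamma> :: real
  assumes "n \<ge> 1"
    and "integrable (jacobi_measure n) (jacobi_weight n \<alpha> \<beta> \<gamma>)"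
    and "integrable (jacobi_measure n) (\<lambda>x. x 0 powr (-2) * jacobi_weight n \<alpha> \<beta> \<gamma> x)"
  shows "jacobi_avg n \<alpha> \<beta> \<gamma> (\<lambda>x. x 0 powr (-2)) =
    (\<alpha> + \<beta> + (real n - 1) * \<gamma> - 1) / ((\<alpha> - 1) * (\<alpha> - 2)) *
    (\<alpha> + \<beta> - 2 + \<gamma> * (real n - 1) * (\<alpha> + \<beta> + real n * \<gamma> - 1) / (\<alpha> + \<gamma> - 1))"
proof -
  let ?W = "selberg_weight n (\<lambda>_. \<alpha>) \<beta> \<gamma>"
  \<comment> \<open>Membership in the space gives \<open>0 \<le> x 0\<close>; at
    \<open>x 0 = 0\<close> both sides are 0 by the conventions for \<open>powr\<close> and
    division.\<close>
  have eq: "x 0 powr (-2) * jacobi_weight n \<alpha> \<beta> \<gamma> x = ?W x * (1 / (x 0)\<^sup>2)"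
    if "x \<in> space (jacobi_measure n)" for x
    using space_jacobi_measure[OF that, of 0] assms(1)
    by (simp add: jacobi_weight_eq_selberg_weight powr_minus_divide powr_numeral)
  have int: "integrable (jacobi_measure n) ?W"
    using assms(2) by (simp add: jacobi_weight_eq_selberg_weight)
  have "integrable (jacobi_measure n) (\<lambda>x. ?W x * (1 / (x 0)\<^sup>2))"
    using assms(3) by (subst Bochner_Integration.integrable_cong[OF refl eq, symmetric])
  note avg = inv_sq_average[OF assms(1) int this]
  have "(\<integral>x. x 0 powr (-2) * jacobi_weight n \<alpha> \<beta> \<gamma> x \<partial>jacobi_measure n)
      = (\<integral>x. ?W x * (1 / (x 0)\<^sup>2) \<partial>jacobi_measure n)"
    by (rule Bochner_Integration.integral_cong[OF refl eq])
  then show ?thesis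
    by (simp only: jacobi_avg_def avg) (simp only: jacobi_weight_eq_selberg_weight avg)
qed

end
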